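(* Let $p$ be a prime number and let $R$ be a perfect $\mathbb{F}_p$-algebra. Then $C(R)$, equipped with the ideals $\mathfrak{a}_i = \widehat{I^i}$ ($i \ge 1$), is a strict $p$-ring with $C(R)/pC(R) = R$ (the identification being induced by the natural projection $\pi : C(R) \to R$).
   Context: All rings are commutative with $1$ and ring homomorphisms map $1$ to $1$. An $\mathbb{F}_p$-algebra $R$ is perfect if the Frobenius $x \mapsto x^p$ is an isomorphism of $R$. A $p$-ring is a commutative ring $A$ with unit which is Hausdorff and complete for the topology defined by a sequence of ideals $\mathfrak{a}_1 \supset \mathfrak{a}_2 \supset \cdots$ such that (1) $\mathfrak{a}_i \mathfrak{a}_j \subset \mathfrak{a}_{i+j}$ for $i,j \ge 1$, and (2) $A/\mathfrak{a}_1$ is a perfect $\mathbb{F}_p$-algebra (called the residue algebra of $A$). A $p$-ring is called strict if $\mathfrak{a}_i = p^i A$ for all $i\ge 1$ and $p$ is not a zero divisor in $A$. $\mathbb{Z}R$ denotes the monoid algebra over $\mathbb{Z}$ of the multiplicative monoid $(R,\cdot)$; its elements are finite formal sums $\sum_{r\in R} n_r [r]$ with $n_r \in \mathbb{Z}$, and $[r][s]=[rs]$ (so $[1]=1$, but $[0]$ is in general not $0$). Let $\pi : \mathbb{Z}R \to R$ be the surjective ring homomorphism $\sum n_r[r] \mapsto \sum n_r r$ and $I = \ker \pi$. Define $C(R) = \varprojlim_{\nu} \mathbb{Z}R/I^{\nu}$, the $I$-adic completion of $\mathbb{Z}R$, and $\widehat{I^i} = \varprojlim_{\nu} I^i/I^{\nu}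 \subset C(R)$ (limit over $\nu \ge i$). The projection $\pi : C(R) \to R$ is the natural map $C(R) \to \mathbb{Z}R/I = R$. *)

theory Defs
  imports
    "HOL-Computational_Algebra.Primes"
    "HOL-Library.Poly_Mapping"
    "HOL-Analysis.T1_Spaces"
    "HOL-Analysis.Abstract_Limits"
    "HOL-Algebra.Algebra"
begin

section \<open>Perfect \<open>F\<^sub>p\<close>-algebras\<close>

text \<open>
  A commutative ring carries at most one \<open>F\<^sub>p\<close>-algebra structure, so being an \<open>F\<^sub>p\<close>-algebra
  is a property: there is a ring homomorphism from \<open>Z/pZ\<close>. The zero ring is not excluded.
\<close>

definition Fp_algebra :: "nat \<Rightarrow> ('a, 'b) ring_scheme \<Rightarrow> bool"
  where "Fp_algebra p R \<longleftrightarrow> cring R \<and> ring_hom (ZFact (int p)) R \<noteq> {}"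

definition perfect_Fp_algebra :: "nat \<Rightarrow> ('a, 'b) ring_scheme \<Rightarrow> bool"
  where "perfect_Fp_algebra p R \<longleftrightarrow>
    Fp_algebra p R \<and> (\<lambda>x. x [^]\<^bsub>R\<^esub> p) \<in> ring_iso R R"


section \<open>The topology defined by a decreasing sequence of ideals\<close>

text \<open>Sequences of ideals are indexed by \<open>i \<ge> 1\<close>; the value at \<open>0\<close> is never used.\<close>

definition decreasing_ideals :: "('a, 'b) ring_scheme \<Rightarrow> (nat \<Rightarrow> 'a set) \<Rightarrow> bool"
  where "decreasing_ideals A \<aa> \<longleftrightarrow>
    (\<forall>i\<ge>1. ideal (\<aa> i) A) \<and> (\<forall>i\<ge>1. \<aa> (Suc i) \<subseteq> \<aa> i)"

definition ideals_topology :: "('a, 'b) ring_scheme \<Rightarrow> (nat \<Rightarrow> 'a set) \<Rightarrow> 'a topology"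
  where "ideals_topology A \<aa> =
    topology (\<lambda>U. U \<subseteq> carrier A \<and> (\<forall>x\<in>U. \<exists>i\<ge>1. \<aa> i +>\<^bsub>A\<^esub> x \<subseteq> U))"

lemma decreasing_ideals_antimono:
  assumes "decreasing_ideals A \<aa>" "1 \<le> i" "i \<le> j"
  shows "\<aa> j \<subseteq> \<aa> i"
  using assms(3)
proof (induction j rule: dec_induct)
  case (step n)
  moreover have "\<aa> (Suc n) \<subseteq> \<aa> n"
    using assms(1,2) step.hyps by (simp add: decreasing_ideals_def)
  ultimately show ?case by blast
qed simp

text \<open>The predicate in the definition does describe a topology.\<close>

lemma openin_ideals_topology:
  assumes "decreasing_ideals A \<aa>"
  shows "openin (ideals_topology A \<aa>) U \<longleftrightarrow>
    U \<subseteq> carrier A \<and> (\<forall>x\<in>U. \<exists>i\<ge>1. \<aa> i +>\<^bsub>A\<^esub> x \<subseteq> U)"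
proof -
  let ?P = "\<lambda>U. U \<subseteq> carrier A \<and> (\<forall>x\<in>U. \<exists>i\<ge>1. \<aa> i +>\<^bsub>A\<^esub> x \<subseteq> U)"
  have mono: "\<aa> j +>\<^bsub>A\<^esub> x \<subseteq> \<aa> i +>\<^bsub>A\<^esub> x" if "1 \<le> i" "i \<le> j" for i j x
    using decreasing_ideals_antimono[OF assms that] by (auto simp: a_r_coset_def')
  have "istopology ?P"
    unfolding istopology_def
  proof (intro conjI allI impI)
    fix S T assume S: "?P S" and T: "?P T"
    show "S \<inter> T \<subseteq> carrier A" using S by blast
    show "\<forall>x\<in>S \<inter> T. \<exists>i\<ge>1. \<aa> i +>\<^bsub>A\<^esub> x \<subseteq> S \<inter> T"
    proof
      fix x assume "x \<in> S \<inter> T"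
      then obtain i j where "1 \<le> i" "\<aa> i +>\<^bsub>A\<^esub> x \<subseteq> S" "1 \<le> j" "\<aa> j +>\<^bsub>A\<^esub> x \<subseteq> T"
        using S T by (meson IntD1 IntD2)
      then have "1 \<le> max i j \<and> \<aa> (max i j) +>\<^bsub>A\<^esub> x \<subseteq> S \<inter> T"
        using mono[of i "max i j" x] mono[of j "max i j" x] by auto
      then show "\<exists>i\<ge>1. \<aa> i +>\<^bsub>A\<^esub> x \<subseteq> S \<inter> T" by blast
    qed
  next
    fix K assume K: "\<forall>S\<in>K. ?P S"
    show "\<Union>K \<subseteq> carrier A" using K by blast
    show "\<forall>x\<in>\<Union>K. \<exists>i\<ge>1. \<aa> i +>\<^bsub>A\<^esub> x \<subseteq> \<Union>K"
      using K by (meson UnionE Union_upper subset_trans)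
  qed
  then show ?thesis by (simp add: ideals_topology_def topology_inverse')
qed

text \<open>
  The neighbourhoods of \<open>0\<close> have a countable base, so completeness can be expressed by
  Cauchy sequences.
\<close>

definition ideals_Cauchy :: "('a, 'b) ring_scheme \<Rightarrow> (nat \<Rightarrow> 'a set) \<Rightarrow> (nat \<Rightarrow> 'a) \<Rightarrow> bool"
  where "ideals_Cauchy A \<aa> s \<longleftrightarrow>
    range s \<subseteq> carrier A \<and> (\<forall>i\<ge>1. \<exists>N. \<forall>m\<ge>N. \<forall>n\<ge>N. s m \<ominus>\<^bsub>A\<^esub> s n \<in> \<aa> i)"

definition ideals_complete :: "('a, 'b) ring_scheme \<Rightarrow> (nat \<Rightarrow> 'a set) \<Rightarrow> bool"
  where "ideals_complete A \<aa> \<longleftrightarrow>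
    (\<forall>s. ideals_Cauchy A \<aa> s \<longrightarrow> (\<exists>l. limitin (ideals_topology A \<aa>) s l sequentially))"


section \<open>\<open>p\<close>-rings\<close>

definition p_ring :: "nat \<Rightarrow> ('a, 'b) ring_scheme \<Rightarrow> (nat \<Rightarrow> 'a set) \<Rightarrow> bool"
  where "p_ring p A \<aa> \<longleftrightarrow>
    cring A \<and>
    decreasing_ideals A \<aa> \<and>
    Hausdorff_space (ideals_topology A \<aa>) \<and>
    ideals_complete A \<aa> \<and>
    (\<forall>i\<ge>1. \<forall>j\<ge>1. \<aa> i \<cdot>\<^bsub>A\<^esub> \<aa> j \<subseteq> \<aa> (i + j)) \<and>
    perfect_Fp_algebra p (A Quot \<aa> 1)"

definition nat_ideal :: "('a, 'b) ring_scheme \<Rightarrow> nat \<Rightarrow> 'a set"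
  where "nat_ideal A n = PIdl\<^bsub>A\<^esub> ([n] \<cdot>\<^bsub>A\<^esub> \<one>\<^bsub>A\<^esub>)"

definition strict_p_ring :: "nat \<Rightarrow> ('a, 'b) ring_scheme \<Rightarrow> (nat \<Rightarrow> 'a set) \<Rightarrow> bool"
  where "strict_p_ring p A \<aa> \<longleftrightarrow>
    p_ring p A \<aa> \<and>
    (\<forall>i\<ge>1. \<aa> i = nat_ideal A (p ^ i)) \<and>
    (\<forall>x\<in>carrier A. ([p] \<cdot>\<^bsub>A\<^esub> \<one>\<^bsub>A\<^esub>) \<otimes>\<^bsub>A\<^esub> x = \<zero>\<^bsub>A\<^esub> \<longrightarrow> x = \<zero>\<^bsub>A\<^esub>)"


section \<open>The monoid algebra over the integers\<close>

text \<open>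
  Finite formal sums are finitely supported functions; \<^term>\<open>frag_of r\<close> is \<open>[r]\<close>, and
  \<^const>\<open>frag_extend\<close> is additive extension, so the product is the biadditive extension of
  \<open>[r][s] = [rs]\<close>.
\<close>

definition monoid_algebra :: "('a, 'b) monoid_scheme \<Rightarrow> ('a \<Rightarrow>\<^sub>0 int) ring"
  where "monoid_algebra G =
    \<lparr>carrier = {c. Poly_Mapping.keys c \<subseteq> carrier G},
     monoid.mult = (\<lambda>c d. frag_extend (\<lambda>r. frag_extend (\<lambda>s. frag_of (r \<otimes>\<^bsub>G\<^esub> s)) d) c),
     one = frag_of \<one>\<^bsub>G\<^esub>,
     ring.zero = 0,
     add = (+)\<rparr>"

definition eval_hom :: "('a, 'b) ring_scheme \<Rightarrow> ('a \<Rightarrow>\<^sub>0 int) \<Rightarrow> 'a"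
  where "eval_hom R c =
    (\<Oplus>\<^bsub>R\<^esub>r\<in>Poly_Mapping.keys c. [Poly_Mapping.lookup c r] \<cdot>\<^bsub>R\<^esub> r)"

definition eval_kernel :: "('a, 'b) ring_scheme \<Rightarrow> ('a \<Rightarrow>\<^sub>0 int) set"
  where "eval_kernel R = a_kernel (monoid_algebra R) R (eval_hom R)"


section \<open>Adic completion\<close>

definition ideal_power :: "('a, 'b) ring_scheme \<Rightarrow> 'a set \<Rightarrow> nat \<Rightarrow> 'a set"
  where "ideal_power A I n = I [^]\<^bsub>ideals_set A\<^esub> n"

text \<open>
  The inverse limit of the rings \<open>A/I\<^sup>\<nu>\<close>, as compatible families of cosets. For \<open>\<nu> \<le> \<mu>\<close> the
  transition map sends a coset \<open>X\<close> of \<open>I\<^sup>\<mu>\<close> to the coset \<open>X + I\<^sup>\<nu>\<close> of \<open>I\<^sup>\<nu>\<close>. The index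
  \<open>\<nu> = 0\<close> only contributes the zero ring \<open>A/A\<close>.
\<close>

definition adic_completion :: "('a, 'b) ring_scheme \<Rightarrow> 'a set \<Rightarrow> (nat \<Rightarrow> 'a set) ring"
  where "adic_completion A I =
    \<lparr>carrier = {x. (\<forall>\<nu>. x \<nu> \<in> carrier (A Quot ideal_power A I \<nu>)) \<and>
                   (\<forall>\<nu> \<mu>. \<nu> \<le> \<mu> \<longrightarrow> x \<mu> <+>\<^bsub>A\<^esub> ideal_power A I \<nu> = x \<nu>)},
     monoid.mult = (\<lambda>x y \<nu>. x \<nu> \<otimes>\<^bsub>A Quot ideal_power A I \<nu>\<^esub> y \<nu>),
     one = (\<lambda>\<nu>. \<one>\<^bsub>A Quot ideal_power A I \<nu>\<^esub>),
     ring.zero = (\<lambda>\<nu>. \<zero>\<^bsub>A Quot ideal_power A I \<nu>\<^esub>),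
     add = (\<lambda>x y \<nu>. x \<nu> \<oplus>\<^bsub>A Quot ideal_power A I \<nu>\<^esub> y \<nu>)\<rparr>"

text \<open>
  The limit of \<open>I\<^sup>i/I\<^sup>\<nu>\<close> over \<open>\<nu> \<ge> i\<close>, inside the completion: the components of index \<open>\<ge> i\<close>
  are classes of elements of \<open>I\<^sup>i\<close>; the remaining ones are determined by compatibility.
\<close>

definition completed_power :: "('a, 'b) ring_scheme \<Rightarrow> 'a set \<Rightarrow> nat \<Rightarrow> (nat \<Rightarrow> 'a set) set"
  where "completed_power A I i =
    {x \<in> carrier (adic_completion A I).
       \<forall>\<nu>\<ge>i. x \<nu> \<in> (\<lambda>a. ideal_power A I \<nu> +>\<^bsub>A\<^esub> a) ` ideal_power A I i}"


section \<open>The ring \<open>C(R)\<close>\<close>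

definition C_ring :: "('a, 'b) ring_scheme \<Rightarrow> (nat \<Rightarrow> ('a \<Rightarrow>\<^sub>0 int) set) ring"
  where "C_ring R = adic_completion (monoid_algebra R) (eval_kernel R)"

definition C_ideal :: "('a, 'b) ring_scheme \<Rightarrow> nat \<Rightarrow> (nat \<Rightarrow> ('a \<Rightarrow>\<^sub>0 int) set) set"
  where "C_ideal R i = completed_power (monoid_algebra R) (eval_kernel R) i"

text \<open>
  The projection to the component \<open>ZR/I\<close>, followed by the identification of \<open>ZR/I\<close> with \<open>R\<close>
  in which a coset corresponds to the common value of \<^const>\<open>eval_hom\<close> on its elements.
\<close>

definition C_proj :: "('a, 'b) ring_scheme \<Rightarrow> (nat \<Rightarrow> ('a \<Rightarrow>\<^sub>0 int) set) \<Rightarrow> 'a"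
  where "C_proj R x = the_elem (eval_hom R ` x 1)"

end

theory Submission
  imports Defs
begin

text \<open>
  Let \<open>A = \<int>R\<close> and let \<open>F\<close> be the ring endomorphism of \<open>A\<close> with \<open>F [r] = [r\<^sup>p]\<close>. As \<open>R\<close> is perfect,
  \<open>F\<close> is an automorphism preserving \<open>I\<close>, and \<open>F(x) \<equiv> x\<^sup>p\<close> modulo \<open>p\<close>. Since \<open>A\<close> has no
  \<open>p\<close>-torsion, \<open>\<delta>(x) = (F(x) - x\<^sup>p)/p\<close> is well defined, and its sum and product rules show that it
  maps \<open>I\<close> to the power \<open>n+1\<close> into \<open>I\<close> to the power \<open>n\<close>. Evaluating \<open>\<delta>(pa)\<close> gives: if \<open>pa\<close> lies in
  the power \<open>n+1\<close> of \<open>I\<close>, then \<open>a\<close> lies in the power \<open>n\<close>. In the other direction, \<open>I = F(I)\<close> is contained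
  in \<open>I\<^sup>2 + pA\<close>, so the power \<open>n\<close> of \<open>I\<close> is the sum of any higher power and \<open>p\<^sup>nA\<close>. On the completion
  the first fact says that \<open>p\<close> is not a zero divisor, and both together that the \<open>i\<close>-th ideal of the
  filtration is generated by \<open>p\<^sup>i\<close>.
\<close>

section \<open>The binomial formula and powers of ideals\<close>

lemma (in cring) binomial_expansion:
  assumes [simp]: "x \<in> carrier R" "y \<in> carrier R"
  shows "(x \<oplus> y) [^] (n::nat) =
    (\<Oplus>k\<in>{..n}. [(n choose k)] \<cdot> (x [^] k \<otimes> y [^] (n - k)))"
proof (induction n)
  case (Suc n)
  \<comment> \<open>Pascal's rule: \<open>g\<close> collects the terms of \<open>f n\<close>
    multiplied by \<open>x\<close>, \<open>h\<close> those multiplied by \<open>y\<close>, and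
    \<open>fgh\<close> adds them after shifting \<open>h\<close> by one index.\<close>
  define f where "f m k = [(m choose k)] \<cdot> (x [^] k \<otimes> y [^] (m - k))" for m k :: nat
  define g where "g k = [(n choose k)] \<cdot> (x [^] Suc k \<otimes> y [^] (n - k))" for k
  define h where "h k = [(n choose k)] \<cdot> (x [^] k \<otimes> y [^] (Suc n - k))" for k
  have f [simp]: "f m k \<in> carrier R" and g [simp]: "g k \<in> carrier R"
    and h [simp]: "h k \<in> carrier R" for m k
    by (auto simp: f_def g_def h_def)
  have x: "f n k \<otimes> x = g k" for k
    by (simp add: f_def g_def add_pow_ldistr add_pow_rdistr m_ac)
  have y: "f n k \<otimes> y = h k" if "k \<le> n" for k
    using that by (simp add: f_def h_def add_pow_ldistr add_pow_rdistr m_ac Suc_diff_le)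
  have fgh: "f (Suc n) (Suc k) = g k \<oplus> h (Suc k)" for k
    by (simp add: f_def g_def h_def flip: add.nat_pow_mult)
  have "(x \<oplus> y) [^] Suc n = finsum R (f n) {..n} \<otimes> (x \<oplus> y)"
    using Suc by (simp add: f_def[abs_def])
  also have "\<dots> = finsum R g {..n} \<oplus> finsum R h {..n}"
  proof -
    have "finsum R (f n) {..n} \<otimes> x = finsum R g {..n}"
      by (simp add: finsum_ldistr x Pi_def)
    moreover have "finsum R (f n) {..n} \<otimes> y = finsum R h {..n}"
      by (subst finsum_ldistr) (auto intro!: finsum_cong' simp: y)
    ultimately show ?thesis by (simp add: r_distr Pi_def)
  qed
  \<comment> \<open>The added term vanishes because \<open>n choose Suc n\<close> is 0. It lets the
    index 0 be split off while the shifted sum still runs over \<open>{..n}\<close>.\<close>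
  also have "finsum R h {..n} = finsum R h {..Suc n}"
    by (simp add: Pi_def) (simp add: h_def binomial_eq_0)
  also have "\<dots> = finsum R (\<lambda>k. h (Suc k)) {..n} \<oplus> h 0"
    by (subst finsum_Suc2) (simp_all add: Pi_def)
  also have "finsum R g {..n} \<oplus> \<dots> = finsum R (\<lambda>k. g k \<oplus> h (Suc k)) {..n} \<oplus> f (Suc n) 0"
    by (simp add: finsum_addf Pi_def a_assoc) (simp add: h_def f_def)
  also have "\<dots> = finsum R (f (Suc n)) {..Suc n}"
    by (subst finsum_Suc2) (auto simp: fgh)
  finally show ?case by (simp add: f_def[abs_def])
qed simp

lemma (in ideal) finsum_mem:
  assumes "f \<in> S \<rightarrow> I"
  shows "finsum R f S \<in> I"
  using assms
proof (induction S rule: infinite_finite_induct)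
  case (insert a S)
  then have "f \<in> S \<rightarrow> carrier R" "f a \<in> carrier R" by (auto simp: Pi_def)
  with insert show ?case by (simp add: finsum_insert)
qed (auto simp: finsum_infinite)

lemma (in ideal) add_pow_mem:
  assumes "x \<in> I"
  shows "[(n::nat)] \<cdot> x \<in> I"
  using assms by (induction n) auto

text \<open>The inner binomial coefficients are divisible by \<open>p\<close>, and every inner term
  contains a positive power of \<open>x\<close>, so the quotient by \<open>p\<close> stays in
  \<open>J\<close>. This membership keeps the sum rule for \<delta> from losing filtration; for
  \<open>J\<close> the whole ring the usual congruence remains.\<close>

lemma (in cring) prime_pow_add:
  assumes p: "Factorial_Ring.prime (p::nat)" and J: "ideal J R" and "x \<in> J" "y \<in> J"
  shows "\<exists>z\<in>J. (x \<oplus> y) [^] p = x [^] p \<oplus> y [^] p \<oplus> ([p] \<cdot> \<one>) \<otimes> z"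
proof -
  interpret J: ideal J R by fact
  have [simp]: "x \<in> carrier R" "y \<in> carrier R" using J.Icarr assms(3,4) by blast+
  \<comment> \<open>With \<open>p = m + 2\<close>, the inner indices 1 to \<open>p - 1\<close> are
    exactly \<open>Suc k\<close> for \<open>k\<close> \<le> \<open>m\<close>.\<close>
  obtain m where m: "p = Suc (Suc m)"
    using prime_ge_2_nat[OF p] that[of "p - 2"] by simp
  define f where "f k = [(p choose k)] \<cdot> (x [^] k \<otimes> y [^] (p - k))" for k
  define g where "g k = [((p choose Suc k) div p)] \<cdot> (x [^] Suc k \<otimes> y [^] (p - Suc k))" for k
  have [simp]: "f k \<in> carrier R" for k by (simp add: f_def)
  have g: "g k \<in> J" for k
    using \<open>x \<in> J\<close> unfolding g_def by (intro J.add_pow_mem J.I_r_closed) (auto intro: J.I_l_closed)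
  have fg: "f (Suc k) = ([p] \<cdot> \<one>) \<otimes> g k" if "k \<le> m" for k
  proof -
    have "p dvd p choose Suc k"
      using that m p by (intro dvd_choose_prime) auto
    then have "p choose Suc k = p * ((p choose Suc k) div p)" by simp
    then have "f (Suc k) = [p] \<cdot> g k"
      unfolding f_def g_def by (subst add.nat_pow_pow) (simp_all add: mult.commute)
    then show ?thesis using J.Icarr[OF g[of k]] by (simp add: add_pow_ldistr)
  qed
  have "(x \<oplus> y) [^] p = finsum R f {..Suc (Suc m)}"
    using binomial_expansion[of x y p] \<open>x \<in> carrier R\<close> \<open>y \<in> carrier R\<close>
    by (simp only: f_def[abs_def] m)
  also have "\<dots> = f p \<oplus> (finsum R (\<lambda>k. f (Suc k)) {..m} \<oplus> f 0)"
    by (subst finsum_Suc, simp, subst finsum_Suc2) (simp_all add: m)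
  also have "finsum R (\<lambda>k. f (Suc k)) {..m} = finsum R (\<lambda>k. ([p] \<cdot> \<one>) \<otimes> g k) {..m}"
    using J.Icarr[OF g] by (intro finsum_cong') (auto simp: fg)
  also have "\<dots> = ([p] \<cdot> \<one>) \<otimes> finsum R g {..m}"
    using J.Icarr[OF g] by (intro finsum_rdistr[symmetric]) auto
  finally show ?thesis
    using J.finsum_mem[of g "{..m}"] g
    by (intro bexI[of _ "finsum R g {..m}"]) (auto simp: f_def J.Icarr a_ac)
qed

section \<open>Powers of an ideal\<close>

context cring
begin

lemma ideal_power_0 [simp]: "ideal_power R I 0 = carrier R"
  by (simp add: ideal_power_def ideals_set_def)

lemma ideal_power_Suc [simp]: "ideal_power R I (Suc n) = ideal_power R I n \<cdot> I"
  by (simp add: ideal_power_def ideals_set_def)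

lemma ideal_ideal_power:
  assumes "ideal I R"
  shows "ideal (ideal_power R I n) R"
  by (induction n) (auto simp: oneideal ideal_prod_is_ideal assms)

lemma ideal_power_1:
  assumes "ideal I R"
  shows "ideal_power R I (Suc 0) = I"
  using ideal_prod_one[OF assms] ideal_prod_commute[OF assms oneideal] by simp

lemma ideal_power_add:
  assumes "ideal I R"
  shows "ideal_power R I m \<cdot> ideal_power R I n = ideal_power R I (m + n)"
proof (induction n)
  case (Suc n)
  then show ?case
    by (simp add: ideal_prod_assoc[symmetric] assms ideal_ideal_power)
qed (simp add: ideal_prod_one ideal_ideal_power assms)

lemma ideal_power_mult_mem:
  assumes "ideal I R" "x \<in> ideal_power R I m" "y \<in> ideal_power R I n"
  shows "x \<otimes> y \<in> ideal_power R I (m + n)"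
  unfolding ideal_power_add[OF assms(1), symmetric] using assms by (intro ideal_prod.prod)

lemma ideal_power_antimono:
  assumes "ideal I R" "m \<le> n"
  shows "ideal_power R I n \<subseteq> ideal_power R I m"
  using assms(2)
proof (induction rule: dec_induct)
  case (step k)
  have "ideal_power R I (Suc k) \<subseteq> ideal_power R I k"
    using ideal_prod_inter[OF ideal_ideal_power[OF assms(1)] assms(1)] by simp
  with step show ?case by blast
qed simp

lemma ideal_power_pow_mem:
  assumes "ideal I R" "x \<in> I"
  shows "x [^] n \<in> ideal_power R I n"
proof (induction n)
  case (Suc n)
  then show ?case using assms by (simp add: ideal_prod.prod)
qed simp

lemma ideal_power_hom_mem:
  assumes I: "ideal I R" and F: "F \<in> ring_hom R R" "F ` I \<subseteq> I" "x \<in> ideal_power R I n"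
  shows "F x \<in> ideal_power R I n"
  using F(3)
proof (induction n arbitrary: x)
  case (Suc n)
  interpret J: ideal "ideal_power R I n" R using I by (rule ideal_ideal_power)
  interpret I: ideal I R by fact
  from Suc.prems have "x \<in> ideal_power R I n \<cdot> I" by simp
  \<comment> \<open>Membership in the carrier is carried through the induction because
    \<open>F\<close> is additive only there.\<close>
  then have "x \<in> carrier R \<and> F x \<in> ideal_power R I n \<cdot> I"
  proof (induction rule: ideal_prod.induct)
    case (prod i j)
    then show ?case
      using ring_hom_mult[OF F(1), of i j] F(2) Suc.IH by (auto intro: ideal_prod.prod)
  next
    case (sum s t)
    then show ?case
      using ring_hom_add[OF F(1), of s t] by (auto intro: ideal_prod.sum)
  qed
  then show ?case by simp
qed (use F in \<open>auto simp: ring_hom_closed\<close>)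

end

section \<open>Ring identities for sums and products of decomposed elements\<close>

lemma (in cring) derivation_add_aux:
  assumes "a \<in> carrier R" "b \<in> carrier R" "c \<in> carrier R"
    "x \<in> carrier R" "y \<in> carrier R" "z \<in> carrier R"
  shows "(a \<oplus> c \<otimes> x) \<oplus> (b \<oplus> c \<otimes> y) = (a \<oplus> b \<oplus> c \<otimes> z) \<oplus> c \<otimes> (x \<oplus> y \<ominus> z)"
  using assms by algebra

lemma (in cring) decomp_mult_aux:
  assumes "a \<in> carrier R" "b \<in> carrier R" "c \<in> carrier R"
    "x \<in> carrier R" "y \<in> carrier R" "z \<in> carrier R"
  shows "a \<oplus> b \<otimes> x \<otimes> (y \<oplus> c \<otimes> z) = (a \<oplus> (b \<otimes> y) \<otimes> x) \<oplus> (b \<otimes> c) \<otimes> (x \<otimes> z)"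
  using assms by algebra

lemma (in cring) decomp_add_aux:
  assumes "a \<in> carrier R" "b \<in> carrier R" "c \<in> carrier R" "x \<in> carrier R" "y \<in> carrier R"
  shows "(a \<oplus> c \<otimes> x) \<oplus> (b \<oplus> c \<otimes> y) = (a \<oplus> b) \<oplus> c \<otimes> (x \<oplus> y)"
  using assms by algebra

locale cring_ideal = cring A + ideal I A for A (structure) and I
begin

abbreviation J where "J \<equiv> ideal_power A I"

lemma ideal_J: "ideal (J n) A"
  by (rule ideal_ideal_power) (rule is_ideal)

lemma J_carr: "x \<in> J n \<Longrightarrow> x \<in> carrier A"
  using ideal_J by (rule ideal.Icarr)

lemma J_add: "x \<in> J n \<Longrightarrow> y \<in> J n \<Longrightarrow> x \<oplus> y \<in> J n"
  using ideal_J[of n] by (simp add: additive_subgroup.a_closed ideal.axioms(1))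

lemma J_minus: "x \<in> J n \<Longrightarrow> y \<in> J n \<Longrightarrow> x \<ominus> y \<in> J n"
  using ideal_J[of n] by (simp add: a_minus_def additive_subgroup.a_closed additive_subgroup.a_inv_closed ideal.axioms(1))

lemma J_zero [simp]: "\<zero> \<in> J n"
  using ideal_J[of n] by (simp add: additive_subgroup.zero_closed ideal.axioms(1))

lemma J_mult: "x \<in> J m \<Longrightarrow> y \<in> J n \<Longrightarrow> x \<otimes> y \<in> J (m + n)"
  using is_ideal by (rule ideal_power_mult_mem)

lemma J_mono: "x \<in> J n \<Longrightarrow> m \<le> n \<Longrightarrow> x \<in> J m"
  using ideal_power_antimono[OF is_ideal] by blast

end

section \<open>Lifts of Frobenius\<close>

locale frobenius_lift = cring_ideal A I for A (structure) and I +
  fixes p :: nat and F G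
  assumes prime_p: "Factorial_Ring.prime p"
    and p_cancel: "x \<in> carrier A \<Longrightarrow> ([p] \<cdot> \<one>) \<otimes> x = \<zero> \<Longrightarrow> x = \<zero>"
    and p_mem: "[p] \<cdot> \<one> \<in> I"
    and F_hom: "F \<in> ring_hom A A" and G_hom: "G \<in> ring_hom A A"
    and F_I: "F ` I \<subseteq> I" and G_I: "G ` I \<subseteq> I"
    and FG: "x \<in> carrier A \<Longrightarrow> F (G x) = x" and GF: "x \<in> carrier A \<Longrightarrow> G (F x) = x"
    and F_cong: "x \<in> carrier A \<Longrightarrow> \<exists>z\<in>carrier A. F x = x [^] p \<oplus> ([p] \<cdot> \<one>) \<otimes> z"
begin

abbreviation P where "P \<equiv> [p] \<cdot> \<one>"

lemma P_carr [simp]: "P \<in> carrier A" by simp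

lemma P_pow_cancel:
  assumes "x \<in> carrier A" "y \<in> carrier A" "P [^] (n::nat) \<otimes> x = P [^] n \<otimes> y"
  shows "x = y"
  using assms
proof (induction n arbitrary: x y)
  case (Suc n)
  have "P [^] n \<otimes> (P \<otimes> x) = P [^] n \<otimes> (P \<otimes> y)"
    using Suc.prems by (simp add: m_assoc)
  with Suc have "P \<otimes> x = P \<otimes> y" by simp
  then have "P \<otimes> (x \<ominus> y) = \<zero>"
    using Suc.prems by (simp add: a_minus_def r_distr r_minus r_neg)
  then have "x \<ominus> y = \<zero>" using p_cancel Suc.prems by simp
  then show ?case using Suc.prems by simp
qed simp

text \<open>
  The arithmetic derivation \<open>\<delta>(x) = (F(x) - x\<^sup>p)/p\<close> lowers the \<open>I\<close>-adic filtration by at most one step.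
\<close>

lemma derivation_ideal_power:
  assumes "x \<in> J (Suc n)"
  shows "\<exists>z\<in>J n. F x = x [^] p \<oplus> P \<otimes> z"
  using assms
proof (induction n arbitrary: x)
  case 0
  then show ?case using F_cong[OF J_carr[OF 0]] by (simp del: ideal_power_Suc)
next
  case (Suc n)
  from Suc.prems have "x \<in> J (Suc n) \<cdot> I" by simp
  \<comment> \<open>The first conjunct is needed in the sum case, where the correction term from
    \<open>prime_pow_add\<close> must lie in the ideal containing both summands.\<close>
  then have "x \<in> J (Suc (Suc n)) \<and> (\<exists>z\<in>J (Suc n). F x = x [^] p \<oplus> P \<otimes> z)"
  proof (induction rule: ideal_prod.induct)
    case (prod x y)
    obtain z where z: "z \<in> J n" "F x = x [^] p \<oplus> P \<otimes> z" using Suc.IH prod by blast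
    have y: "y \<in> carrier A" "y \<in> J (Suc 0)" using prod ideal_power_1[OF is_ideal] by auto
    obtain w where w: "w \<in> carrier A" "F y = y [^] p \<oplus> P \<otimes> w" using F_cong y by blast
    note carr = J_carr[OF z(1)] J_carr[OF prod(1)] w(1) y(1) ring_hom_closed[OF F_hom]
    have Fy: "F y \<in> J (Suc 0)"
      using ideal_power_hom_mem[OF is_ideal F_hom F_I y(2)] .
    obtain q where q: "p = Suc q" using prime_gt_0_nat[OF prime_p] that[of "p - 1"] by simp
    have xp: "x [^] p \<in> J (Suc n)"
      using prod(1) carr unfolding q by (simp del: ideal_power_Suc add: ideal.I_l_closed[OF ideal_J])
    \<comment> \<open>Product rule: \<delta>(xy) = x^p \<delta>(y) + \<delta>(x) F(y), with
      \<open>z\<close> for \<delta>(x) and \<open>w\<close> for \<delta>(y). The first term lies in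
      \<open>J (Suc n)\<close> because x^p does, the second because \<open>F y\<close> is in
      \<open>I\<close> and makes up for the step lost by \<open>z\<close>.\<close>
    have "F (x \<otimes> y) = (x [^] p \<oplus> P \<otimes> z) \<otimes> F y"
      using carr z ring_hom_mult[OF F_hom] by simp
    also have "\<dots> = x [^] p \<otimes> (y [^] p \<oplus> P \<otimes> w) \<oplus> P \<otimes> (z \<otimes> F y)"
      using carr by (simp add: l_distr w(2)[symmetric] m_assoc)
    also have "\<dots> = (x \<otimes> y) [^] p \<oplus> P \<otimes> (x [^] p \<otimes> w \<oplus> z \<otimes> F y)"
      using carr by (simp add: r_distr nat_pow_distrib a_assoc m_lcomm)
    finally have "F (x \<otimes> y) = (x \<otimes> y) [^] p \<oplus> P \<otimes> (x [^] p \<otimes> w \<oplus> z \<otimes> F y)" .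
    moreover have "x [^] p \<otimes> w \<oplus> z \<otimes> F y \<in> J (Suc n)"
    proof (rule J_add)
      show "x [^] p \<otimes> w \<in> J (Suc n)"
        using ideal_J xp w(1) by (rule ideal.I_r_closed)
      show "z \<otimes> F y \<in> J (Suc n)"
        using J_mult[OF z(1) Fy] unfolding add_Suc_right add_0_right .
    qed
    moreover have "x \<otimes> y \<in> J (Suc (Suc n))"
      using prod by (simp add: ideal_prod.prod)
    ultimately show ?case by blast
  next
    case (sum x y)
    then obtain z w where z: "z \<in> J (Suc n)" "F x = x [^] p \<oplus> P \<otimes> z"
      and w: "w \<in> J (Suc n)" "F y = y [^] p \<oplus> P \<otimes> w" by blast
    obtain v where v: "v \<in> J (Suc (Suc n))" "(x \<oplus> y) [^] p = x [^] p \<oplus> y [^] p \<oplus> P \<otimes> v"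
      using prime_pow_add[OF prime_p ideal_J] sum by blast
    have carr: "x \<in> carrier A" "y \<in> carrier A" "z \<in> carrier A" "w \<in> carrier A" "v \<in> carrier A"
      using sum z w v J_carr by blast+
    \<comment> \<open>Sum rule: \<delta>(x+y) = \<delta>(x) + \<delta>(y) - v, where
      \<open>v\<close> is the carry of the p-th power of the sum.\<close>
    have "F (x \<oplus> y) = (x [^] p \<oplus> P \<otimes> z) \<oplus> (y [^] p \<oplus> P \<otimes> w)"
      using carr z w ring_hom_add[OF F_hom] by simp
    also have "\<dots> = (x [^] p \<oplus> y [^] p \<oplus> P \<otimes> v) \<oplus> P \<otimes> (z \<oplus> w \<ominus> v)"
      using carr by (intro derivation_add_aux) auto
    finally have "F (x \<oplus> y) = (x \<oplus> y) [^] p \<oplus> P \<otimes> (z \<oplus> w \<ominus> v)" using v by simp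
    moreover have "z \<oplus> w \<ominus> v \<in> J (Suc n)"
      using J_mono[OF v(1), of "Suc n"] z w by (intro J_minus J_add) auto
    ultimately show ?case using sum J_add by blast
  qed
  then show ?case by blast
qed

text \<open>Since \<open>F\<close> fixes \<open>P\<close>, dividing the formula for
  \<open>F (P \<otimes> a)\<close> by \<open>P\<close> gives F(a) = a (Pa)^(p-1) + \<delta>(Pa).
  Both terms lie in \<open>J n\<close>, and \<open>G\<close> brings the membership back from
  \<open>F a\<close> to \<open>a\<close>.\<close>

lemma ideal_power_cancel_p:
  assumes a: "a \<in> carrier A" and "P \<otimes> a \<in> J (Suc n)"
  shows "a \<in> J n"
proof -
  obtain z where z: "z \<in> J n" "F (P \<otimes> a) = (P \<otimes> a) [^] p \<oplus> P \<otimes> z"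
    using derivation_ideal_power assms by blast
  have FP: "F P = P"
  proof -
    interpret ring_hom_cring A A F using F_hom by unfold_locales
    have "F ([n] \<cdot> \<one>) = [n] \<cdot> \<one>" for n :: nat by (induction n) auto
    then show ?thesis .
  qed
  \<comment> \<open>As \<open>p\<close> is at least 2, the exponent \<open>Suc q = p - 1\<close> is
    positive, so \<open>?u\<close> still has a factor \<open>P \<otimes> a\<close> from the
    ideal.\<close>
  obtain q where q: "p = Suc (Suc q)"
    using prime_ge_2_nat[OF prime_p] that[of "p - 2"] by simp
  let ?u = "(P \<otimes> a) [^] Suc q"
  have u: "?u \<in> J n"
    unfolding nat_pow_Suc
    using a by (intro ideal.I_l_closed[OF ideal_J] J_mono[OF assms(2)]) auto
  have "P \<otimes> F a = (P \<otimes> a) [^] p \<oplus> P \<otimes> z"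
    using z ring_hom_mult[OF F_hom P_carr a] FP by simp
  also have "(P \<otimes> a) [^] p = P \<otimes> (a \<otimes> ?u)"
    using a unfolding q nat_pow_Suc by (simp add: m_ac)
  also have "P \<otimes> (a \<otimes> ?u) \<oplus> P \<otimes> z = P \<otimes> (a \<otimes> ?u \<oplus> z)"
    using a z J_carr by (simp add: r_distr)
  finally have "F a = a \<otimes> ?u \<oplus> z"
    using P_pow_cancel[of "F a" "a \<otimes> ?u \<oplus> z" 1] a z J_carr ring_hom_closed[OF F_hom] by simp
  then have "F a \<in> J n"
    using J_add[OF ideal.I_l_closed[OF ideal_J u a] z(1)] by simp
  then show ?thesis
    using ideal_power_hom_mem[OF is_ideal G_hom G_I, of "F a" n] GF[OF a] by simp
qed

lemma ideal_power_cancel_p_pow: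
  assumes "a \<in> carrier A" and "P [^] k \<otimes> a \<in> J (n + k)"
  shows "a \<in> J n"
  using assms
proof (induction k arbitrary: a)
  case (Suc k)
  have "P [^] k \<otimes> (P \<otimes> a) = P [^] Suc k \<otimes> a"
    using Suc.prems by (simp add: m_assoc)
  moreover have "P \<otimes> (P [^] k \<otimes> a) = P [^] Suc k \<otimes> a"
    using Suc.prems by (simp add: m_ac)
  ultimately have "P [^] k \<otimes> a \<in> J (n + k)"
    using ideal_power_cancel_p[of "P [^] k \<otimes> a" "n + k"] Suc.prems by simp
  with Suc show ?case by simp
qed simp

text \<open>Induction on \<open>n\<close>, multiplying a decomposition of an element of
  \<open>J n\<close> by the inclusion of \<open>I\<close> in I^2 + pA.\<close>

lemma ideal_power_decomp_Suc:
  assumes "x \<in> J n"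
  shows "\<exists>y\<in>J (Suc n). \<exists>z\<in>carrier A. x = y \<oplus> P [^] n \<otimes> z"
  using assms
proof (induction n arbitrary: x)
  case 0
  then show ?case
    by (intro bexI[of _ \<zero>] bexI[of _ x]) (auto simp: additive_subgroup.zero_closed ideal.axioms(1) ideal_prod_is_ideal oneideal is_ideal)
next
  case (Suc n)
  \<comment> \<open>Here \<open>j = F (G j)\<close> is congruent to (G j)^p modulo \<open>p\<close>,
    and this power lies in I^2 because \<open>p\<close> is at least 2.\<close>
  have I_sub: "\<exists>y\<in>J (Suc (Suc 0)). \<exists>z\<in>carrier A. j = y \<oplus> P \<otimes> z" if "j \<in> I" for j
  proof -
    have "G j \<in> I" using G_I that by blast
    moreover from this have "G j [^] p \<in> J (Suc (Suc 0))"
      using prime_ge_2_nat[OF prime_p]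
      by (intro J_mono[OF ideal_power_pow_mem[OF is_ideal]]) simp_all
    moreover have "\<exists>z\<in>carrier A. j = G j [^] p \<oplus> P \<otimes> z"
      using F_cong[OF Icarr[OF \<open>G j \<in> I\<close>]] FG[OF Icarr[OF that]] by simp
    ultimately show ?thesis by blast
  qed
  from Suc.prems have "x \<in> J n \<cdot> I" by simp
  then show ?case
  proof (induction rule: ideal_prod.induct)
    case (prod i j)
    obtain y z where yz: "y \<in> J (Suc n)" "z \<in> carrier A" "i = y \<oplus> P [^] n \<otimes> z"
      using Suc.IH prod by blast
    obtain v w where vw: "v \<in> J (Suc (Suc 0))" "w \<in> carrier A" "j = v \<oplus> P \<otimes> w"
      using I_sub prod by blast
    have carr: "y \<in> carrier A" "v \<in> carrier A" "j \<in> carrier A" "P [^] n \<in> carrier A"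
      using J_carr[OF yz(1)] J_carr[OF vw(1)] Icarr[OF prod(2)] by auto
    \<comment> \<open>Only the second occurrence of \<open>j\<close> is expanded:
      \<open>y \<otimes> j\<close> already has the right order. Since \<open>P\<close> lies in
      \<open>I\<close>, so does \<open>P [^] n \<otimes> v\<close>.\<close>
    have "i \<otimes> j = y \<otimes> j \<oplus> P [^] n \<otimes> z \<otimes> (v \<oplus> P \<otimes> w)"
      using carr yz by (simp add: l_distr vw(3)[symmetric])
    also have "\<dots> = (y \<otimes> j \<oplus> (P [^] n \<otimes> v) \<otimes> z) \<oplus> (P [^] n \<otimes> P) \<otimes> (z \<otimes> w)"
      using carr yz(2) vw(2) by (intro decomp_mult_aux) auto
    finally have "i \<otimes> j = (y \<otimes> j \<oplus> (P [^] n \<otimes> v) \<otimes> z) \<oplus> P [^] Suc n \<otimes> (z \<otimes> w)" by simp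
    moreover have "y \<otimes> j \<in> J (Suc (Suc n))"
      using yz prod by (simp add: ideal_prod.prod)
    moreover have "P [^] n \<otimes> v \<in> J (Suc (Suc n))"
      using J_mult[OF ideal_power_pow_mem[OF is_ideal p_mem] vw(1), of n] by simp
    ultimately show ?case
      using J_add[OF _ ideal.I_r_closed[OF ideal_J]] yz(2) vw(2) by (meson m_closed)
  next
    case (sum x1 x2)
    then obtain y z v w where yz: "y \<in> J (Suc (Suc n))" "z \<in> carrier A" "x1 = y \<oplus> P [^] Suc n \<otimes> z"
       and vw: "v \<in> J (Suc (Suc n))" "w \<in> carrier A" "x2 = v \<oplus> P [^] Suc n \<otimes> w" by blast
    have "x1 \<oplus> x2 = (y \<oplus> v) \<oplus> P [^] Suc n \<otimes> (z \<oplus> w)"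
      unfolding yz(3) vw(3) using yz(2) vw(2) J_carr[OF yz(1)] J_carr[OF vw(1)]
      by (intro decomp_add_aux) (auto intro!: nat_pow_closed simp del: nat_pow_Suc)
    then show ?case
      using J_add[OF yz(1) vw(1)] add.m_closed[OF yz(2) vw(2)] by blast
  qed
qed

lemma ideal_power_decomp:
  assumes "x \<in> J n"
  shows "\<exists>y\<in>J (n + k). \<exists>z\<in>carrier A. x = y \<oplus> P [^] n \<otimes> z"
proof (induction k)
  case 0
  from assms show ?case using J_carr[OF assms]
    by (intro bexI[of _ x] bexI[of _ \<zero>]) auto
next
  case (Suc k)
  then obtain y z where yz: "y \<in> J (n + k)" "z \<in> carrier A" "x = y \<oplus> P [^] n \<otimes> z" by blast
  \<comment> \<open>Only the remainder \<open>y\<close> is decomposed again; the factor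
    \<open>P [^] (n + k)\<close> that arises is absorbed into the multiple of
    \<open>P [^] n\<close>.\<close>
  obtain v w where vw: "v \<in> J (n + Suc k)" "w \<in> carrier A" "y = v \<oplus> P [^] (n + k) \<otimes> w"
    using ideal_power_decomp_Suc[OF yz(1)] by auto
  have "x = v \<oplus> P [^] n \<otimes> (P [^] k \<otimes> w \<oplus> z)"
    unfolding yz(3) vw(3) nat_pow_mult[OF P_carr, symmetric]
    using J_carr[OF vw(1)] vw(2) yz(2) by (simp add: r_distr a_assoc m_assoc)
  moreover have "P [^] k \<otimes> w \<oplus> z \<in> carrier A" using vw yz by simp
  ultimately show ?case using vw(1) by blast
qed

end

section \<open>Adic completions\<close>

lemma topspace_ideals_topology:
  assumes "decreasing_ideals A \<aa>"
  shows "topspace (ideals_topology A \<aa>) = carrier A"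
proof -
  have "ideal (\<aa> 1) A" using assms by (simp add: decreasing_ideals_def)
  then interpret ideal "\<aa> 1" A .
  have "\<aa> 1 +>\<^bsub>A\<^esub> x \<subseteq> carrier A" if "x \<in> carrier A" for x
    using a_subset that by (rule a_r_coset_subset_G)
  then have "openin (ideals_topology A \<aa>) (carrier A)"
    unfolding openin_ideals_topology[OF assms] by (metis order.refl)
  then show ?thesis
    using openin_ideals_topology[OF assms] openin_subset openin_topspace by (metis subset_antisym)
qed

text \<open>A coset is also the coset of each of its points, so it is a neighbourhood of all of
  them.\<close>

lemma openin_ideals_topology_coset:
  assumes "decreasing_ideals A \<aa>" "1 \<le> i" "x \<in> carrier A"
  shows "openin (ideals_topology A \<aa>) (\<aa> i +>\<^bsub>A\<^esub> x)"
proof -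
  have "ideal (\<aa> i) A" using assms by (simp add: decreasing_ideals_def)
  then interpret ideal "\<aa> i" A .
  have "\<aa> i +>\<^bsub>A\<^esub> y = \<aa> i +>\<^bsub>A\<^esub> x" if "y \<in> \<aa> i +>\<^bsub>A\<^esub> x" for y
    using a_repr_independence'[OF that assms(3)] by simp
  then show ?thesis
    unfolding openin_ideals_topology[OF assms(1)]
    using a_r_coset_subset_G[OF a_subset assms(3)] assms(2) by blast
qed

text \<open>Some ideal of the sequence omits the difference of two distinct points, and distinct
  cosets of that ideal are disjoint open sets.\<close>

lemma Hausdorff_space_ideals_topology:
  assumes "decreasing_ideals A \<aa>" "(\<Inter>i\<in>{1..}. \<aa> i) \<subseteq> {\<zero>\<^bsub>A\<^esub>}"
  shows "Hausdorff_space (ideals_topology A \<aa>)"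
  unfolding Hausdorff_space_def topspace_ideals_topology[OF assms(1)]
proof (intro allI impI)
  fix x y assume xy: "x \<in> carrier A \<and> y \<in> carrier A \<and> x \<noteq> y"
  have "ideal (\<aa> 1) A" using assms by (simp add: decreasing_ideals_def)
  then interpret A: ring A by (rule ideal.axioms(2))
  have "x \<ominus>\<^bsub>A\<^esub> y \<noteq> \<zero>\<^bsub>A\<^esub>" using xy by simp
  then obtain i where i: "i \<ge> 1" "x \<ominus>\<^bsub>A\<^esub> y \<notin> \<aa> i" using assms(2) by auto
  have "ideal (\<aa> i) A" using assms i by (simp add: decreasing_ideals_def)
  then interpret ideal "\<aa> i" A .
  have ne: "\<aa> i +>\<^bsub>A\<^esub> x \<noteq> \<aa> i +>\<^bsub>A\<^esub> y"
    using A.quotient_eq_iff_same_a_r_cos[OF is_ideal, of x y] xy i by blast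
  have "disjnt (\<aa> i +>\<^bsub>A\<^esub> x) (\<aa> i +>\<^bsub>A\<^esub> y)"
    using a_repr_independence'[of _ x] a_repr_independence'[of _ y] xy ne
    unfolding disjnt_iff by metis
  then show "\<exists>U V. openin (ideals_topology A \<aa>) U \<and> openin (ideals_topology A \<aa>) V \<and>
      x \<in> U \<and> y \<in> V \<and> disjnt U V"
    using openin_ideals_topology_coset[OF assms(1) i(1)] a_rcos_self xy by blast
qed

lemma limitin_ideals_topology:
  assumes "decreasing_ideals A \<aa>" "l \<in> carrier A" "range s \<subseteq> carrier A"
    and "\<And>i. i \<ge> 1 \<Longrightarrow> eventually (\<lambda>n. s n \<ominus>\<^bsub>A\<^esub> l \<in> \<aa> i) sequentially"
  shows "limitin (ideals_topology A \<aa>) s l sequentially"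
  unfolding limitin_def topspace_ideals_topology[OF assms(1)]
proof (intro conjI allI impI assms(2))
  fix U assume "openin (ideals_topology A \<aa>) U \<and> l \<in> U"
  then obtain i where i: "i \<ge> 1" "\<aa> i +>\<^bsub>A\<^esub> l \<subseteq> U"
    unfolding openin_ideals_topology[OF assms(1)] by blast
  have "ideal (\<aa> i) A" using assms i by (simp add: decreasing_ideals_def)
  then interpret ideal "\<aa> i" A .
  have "s n \<in> U" if "s n \<ominus>\<^bsub>A\<^esub> l \<in> \<aa> i" for n
    using a_rcos_module_minus[OF ring_axioms assms(2), of "s n"] that assms(3) i(2) by blast
  then show "eventually (\<lambda>n. s n \<in> U) sequentially"
    by (rule eventually_mono[OF assms(4)[OF i(1)]])
qed

section \<open>The completion, described by sequences of representatives\<close>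

context cring_ideal
begin

abbreviation C where "C \<equiv> adic_completion A I"

lemma coset_eq_iff:
  assumes "x \<in> carrier A" "y \<in> carrier A"
  shows "J n +> x = J n +> y \<longleftrightarrow> x \<ominus> y \<in> J n"
  using quotient_eq_iff_same_a_r_cos[OF ideal_J assms] by simp

lemma coset_eq_J_iff:
  assumes "x \<in> carrier A"
  shows "J n +> x = J n \<longleftrightarrow> x \<in> J n"
  using coset_eq_iff[OF assms add.one_closed, of n] assms J_carr
  by (simp add: minus_eq) (metis a_coset_add_zero subsetI)

text \<open>This computes the transition maps of the inverse limit on representatives.\<close>

lemma coset_add_J:
  assumes "x \<in> carrier A" "n \<le> m"
  shows "(J m +> x) <+> J n = J n +> x"
proof -
  have 1: "h \<oplus> x \<oplus> k = (h \<oplus> k) \<oplus> x" "h \<oplus> k \<in> J n" if "h \<in> J m" "k \<in> J n" for h k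
    using J_carr[OF that(1)] J_carr[OF that(2)] assms J_add[OF J_mono[OF that(1) assms(2)] that(2)]
    by (simp_all add: a_ac)
  have 2: "k \<oplus> x = \<zero> \<oplus> x \<oplus> k" if "k \<in> J n" for k
    using J_carr[OF that] assms by (simp add: a_ac)
  show ?thesis
  proof (intro subset_antisym subsetI)
    fix y :: 'a assume "y \<in> (J m +> x) <+> J n"
    then obtain h k where "h \<in> J m" "k \<in> J n" "y = h \<oplus> x \<oplus> k"
      unfolding set_add_def' a_r_coset_def' by blast
    then show "y \<in> J n +> x" unfolding a_r_coset_def' using 1 by blast
  next
    fix y assume "y \<in> J n +> x"
    then obtain k where "k \<in> J n" "y = k \<oplus> x" unfolding a_r_coset_def' by blast
    then show "y \<in> (J m +> x) <+> J n"
      unfolding set_add_def' a_r_coset_def' using 2 J_zero[of m] by blast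
  qed
qed

text \<open>Working with one representative per level replaces computations with cosets. Comparing
  consecutive terms is enough, since the differences telescope.\<close>

definition coherent :: "(nat \<Rightarrow> 'a) \<Rightarrow> bool"
  where "coherent a \<longleftrightarrow> range a \<subseteq> carrier A \<and> (\<forall>n. a (Suc n) \<ominus> a n \<in> J n)"

definition seq_class :: "(nat \<Rightarrow> 'a) \<Rightarrow> nat \<Rightarrow> 'a set"
  where "seq_class a = (\<lambda>n. J n +> a n)"

lemma coherent_carr [simp]: "coherent a \<Longrightarrow> a n \<in> carrier A"
  by (auto simp: coherent_def)

lemma coherent_step: "coherent a \<Longrightarrow> a (Suc n) \<ominus> a n \<in> J n"
  by (simp add: coherent_def)

lemma coherentI:
  assumes "\<And>n. a n \<in> carrier A" "\<And>n. a (Suc n) \<ominus> a n \<in> J n"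
  shows "coherent a"
  using assms by (auto simp: coherent_def)

lemma coherent_le:
  assumes "coherent a" "n \<le> m"
  shows "a m \<ominus> a n \<in> J n"
  using assms(2)
proof (induction m rule: dec_induct)
  case base
  then show ?case
    using assms by (simp add: minus_eq r_neg)
next
  case (step m)
  have "a (Suc m) \<ominus> a m \<in> J n"
    using coherent_step[OF assms(1)] step.hyps(1) by (rule J_mono)
  from J_add[OF this step.IH]
  have "a (Suc m) \<ominus> a m \<oplus> (a m \<ominus> a n) \<in> J n" .
  also have "a (Suc m) \<ominus> a m \<oplus> (a m \<ominus> a n) = a (Suc m) \<ominus> a n"
    using coherent_carr[OF assms(1)] by (simp add: a_minus_def a_assoc) (simp add: a_assoc[symmetric] l_neg)
  finally show ?case .
qed

lemma coherent_const: "x \<in> carrier A \<Longrightarrow> coherent (\<lambda>_. x)"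
  by (auto simp: coherent_def minus_eq r_neg)

lemma coherent_add:
  assumes "coherent a" "coherent b"
  shows "coherent (\<lambda>n. a n \<oplus> b n)"
proof -
  have "(a (Suc n) \<oplus> b (Suc n)) \<ominus> (a n \<oplus> b n) = (a (Suc n) \<ominus> a n) \<oplus> (b (Suc n) \<ominus> b n)" for n
    using coherent_carr[OF assms(1), of n] coherent_carr[OF assms(1), of "Suc n"]
      coherent_carr[OF assms(2), of n] coherent_carr[OF assms(2), of "Suc n"] by algebra
  then show ?thesis
    using J_add[OF coherent_step[OF assms(1)] coherent_step[OF assms(2)]] assms
    by (intro coherentI) simp_all
qed

lemma coherent_mult:
  assumes "coherent a" "coherent b"
  shows "coherent (\<lambda>n. a n \<otimes> b n)"
proof -
  have "(a (Suc n) \<otimes> b (Suc n)) \<ominus> (a n \<otimes> b n)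
      = (a (Suc n) \<ominus> a n) \<otimes> b (Suc n) \<oplus> a n \<otimes> (b (Suc n) \<ominus> b n)" for n
    using coherent_carr[OF assms(1), of n] coherent_carr[OF assms(1), of "Suc n"]
      coherent_carr[OF assms(2), of n] coherent_carr[OF assms(2), of "Suc n"] by algebra
  moreover have "(a (Suc n) \<ominus> a n) \<otimes> b (Suc n) \<oplus> a n \<otimes> (b (Suc n) \<ominus> b n) \<in> J n" for n
    using assms by (intro J_add ideal.I_r_closed[OF ideal_J] ideal.I_l_closed[OF ideal_J]
      coherent_step coherent_carr)
  ultimately show ?thesis using assms by (intro coherentI) simp_all
qed

lemma coherent_minus:
  assumes "coherent a"
  shows "coherent (\<lambda>n. \<ominus> a n)"
proof -
  have "coherent (\<lambda>n. \<ominus> \<one> \<otimes> a n)"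
    using coherent_mult[OF coherent_const assms, of "\<ominus> \<one>"] by simp
  moreover have "\<ominus> \<one> \<otimes> a n = \<ominus> a n" for n
    using coherent_carr[OF assms] by (simp add: l_minus)
  ultimately show ?thesis by simp
qed

lemma seq_class_closed:
  assumes "coherent a"
  shows "seq_class a \<in> carrier C"
proof -
  have "J m +> a m <+> J n = J n +> a n" if "n \<le> m" for m n
    using coset_add_J[OF coherent_carr[OF assms] that] coherent_le[OF assms that]
      coset_eq_iff assms by simp
  then show ?thesis
    using coherent_carr[OF assms]
    by (auto simp: adic_completion_def seq_class_def FactRing_def A_RCOSETS_def')
qed

text \<open>Any choice of representatives of the components is coherent, because compatibility of
  consecutive components says just that.\<close>

lemma carrier_C_cases:
  assumes "x \<in> carrier C"
  obtains a where "coherent a" "x = seq_class a"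
proof -
  have "\<forall>n. \<exists>a\<in>carrier A. x n = J n +> a"
    using assms by (auto simp: adic_completion_def FactRing_def A_RCOSETS_def')
  then obtain a where a: "a n \<in> carrier A" "x n = J n +> a n" for n by metis
  have "J n +> a (Suc n) = J n +> a n" for n
  proof -
    have "x (Suc n) <+> J n = x n"
      using assms by (auto simp: adic_completion_def)
    then show ?thesis using coset_add_J[OF a(1), of n "Suc n" "Suc n"] a(2) by simp
  qed
  then have "coherent a"
    using a(1) coset_eq_iff by (intro coherentI) simp_all
  moreover have "x = seq_class a" using a by (auto simp: seq_class_def)
  ultimately show ?thesis by (rule that)
qed

lemma seq_class_eq_iff:
  assumes "coherent a" "coherent b"
  shows "seq_class a = seq_class b \<longleftrightarrow> (\<forall>n. a n \<ominus> b n \<in> J n)"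
  using assms coset_eq_iff by (simp add: seq_class_def fun_eq_iff)

lemma mult_seq_class:
  assumes "coherent a" "coherent b"
  shows "seq_class a \<otimes>\<^bsub>C\<^esub> seq_class b = seq_class (\<lambda>n. a n \<otimes> b n)"
  using assms ideal.rcoset_mult_add[OF ideal_J]
  by (simp add: adic_completion_def seq_class_def FactRing_def)

lemma add_seq_class:
  assumes "coherent a" "coherent b"
  shows "seq_class a \<oplus>\<^bsub>C\<^esub> seq_class b = seq_class (\<lambda>n. a n \<oplus> b n)"
  using assms ideal.a_rcos_sum[OF ideal_J]
  by (simp add: adic_completion_def seq_class_def FactRing_def)

lemma one_C: "\<one>\<^bsub>C\<^esub> = seq_class (\<lambda>_. \<one>)"
  by (simp add: adic_completion_def seq_class_def FactRing_def)

lemma zero_C: "\<zero>\<^bsub>C\<^esub> = seq_class (\<lambda>_. \<zero>)"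
proof -
  have "J n +> \<zero> = J n" for n
    by (simp add: coset_eq_J_iff)
  then show ?thesis by (simp add: adic_completion_def seq_class_def FactRing_def)
qed

lemmas coherent_intros = coherent_add coherent_mult coherent_minus coherent_const

text \<open>Each ring law holds termwise for coherent sequences and passes to their classes.\<close>

lemma cring_C: "cring C"
proof (rule cringI)
  show "abelian_group C"
  proof (rule abelian_groupI)
    fix x y z assume "x \<in> carrier C" "y \<in> carrier C" "z \<in> carrier C"
    then obtain a b c where "coherent a" "x = seq_class a" "coherent b" "y = seq_class b"
      "coherent c" "z = seq_class c" by (metis carrier_C_cases)
    then show "x \<oplus>\<^bsub>C\<^esub> y \<in> carrier C" "x \<oplus>\<^bsub>C\<^esub> y = y \<oplus>\<^bsub>C\<^esub> x"
      "x \<oplus>\<^bsub>C\<^esub> y \<oplus>\<^bsub>C\<^esub> z = x \<oplus>\<^bsub>C\<^esub> (y \<oplus>\<^bsub>C\<^esub> z)"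
      by (simp_all add: add_seq_class coherent_intros seq_class_closed a_ac)
  next
    fix x assume "x \<in> carrier C"
    then obtain a where a: "coherent a" "x = seq_class a" by (rule carrier_C_cases)
    then show "\<zero>\<^bsub>C\<^esub> \<oplus>\<^bsub>C\<^esub> x = x"
      by (simp add: add_seq_class zero_C coherent_intros)
    from a have "seq_class (\<lambda>n. \<ominus> a n) \<oplus>\<^bsub>C\<^esub> x = \<zero>\<^bsub>C\<^esub>"
      by (simp add: add_seq_class zero_C coherent_intros l_neg)
    with a show "\<exists>y\<in>carrier C. y \<oplus>\<^bsub>C\<^esub> x = \<zero>\<^bsub>C\<^esub>"
      using seq_class_closed[OF coherent_minus] by blast
  qed (simp add: zero_C seq_class_closed coherent_intros)
  show "comm_monoid C"
  proof (rule comm_monoidI)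
    fix x y z assume "x \<in> carrier C" "y \<in> carrier C" "z \<in> carrier C"
    then obtain a b c where "coherent a" "x = seq_class a" "coherent b" "y = seq_class b"
      "coherent c" "z = seq_class c" by (metis carrier_C_cases)
    then show "x \<otimes>\<^bsub>C\<^esub> y \<in> carrier C" "x \<otimes>\<^bsub>C\<^esub> y = y \<otimes>\<^bsub>C\<^esub> x"
      "x \<otimes>\<^bsub>C\<^esub> y \<otimes>\<^bsub>C\<^esub> z = x \<otimes>\<^bsub>C\<^esub> (y \<otimes>\<^bsub>C\<^esub> z)"
      by (simp_all add: mult_seq_class coherent_intros seq_class_closed m_ac)
  next
    fix x assume "x \<in> carrier C"
    then obtain a where a: "coherent a" "x = seq_class a" by (rule carrier_C_cases)
    then show "\<one>\<^bsub>C\<^esub> \<otimes>\<^bsub>C\<^esub> x = x"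
      by (simp add: mult_seq_class one_C coherent_intros)
  qed (simp add: one_C seq_class_closed coherent_intros)
next
  fix x y z assume "x \<in> carrier C" "y \<in> carrier C" "z \<in> carrier C"
  then obtain a b c where "coherent a" "x = seq_class a" "coherent b" "y = seq_class b"
    "coherent c" "z = seq_class c" by (metis carrier_C_cases)
  then show "(x \<oplus>\<^bsub>C\<^esub> y) \<otimes>\<^bsub>C\<^esub> z = x \<otimes>\<^bsub>C\<^esub> z \<oplus>\<^bsub>C\<^esub> y \<otimes>\<^bsub>C\<^esub> z"
    by (simp add: mult_seq_class add_seq_class coherent_intros l_distr)
qed

sublocale C: cring C
  by (rule cring_C)

lemma proj_hom: "(\<lambda>x. x n) \<in> ring_hom C (A Quot J n)"
  by (rule ring_hom_memI) (auto simp: adic_completion_def)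

lemma minus_seq_class:
  assumes "coherent a" "coherent b"
  shows "seq_class a \<ominus>\<^bsub>C\<^esub> seq_class b = seq_class (\<lambda>n. a n \<ominus> b n)"
proof -
  have "seq_class (\<lambda>n. \<ominus> b n) \<oplus>\<^bsub>C\<^esub> seq_class b = \<zero>\<^bsub>C\<^esub>"
    using assms by (simp add: add_seq_class zero_C coherent_intros l_neg)
  then have "\<ominus>\<^bsub>C\<^esub> seq_class b = seq_class (\<lambda>n. \<ominus> b n)"
    using assms by (intro C.minus_equality) (simp_all add: seq_class_closed coherent_minus)
  then show ?thesis
    using assms by (simp add: C.minus_eq minus_eq add_seq_class coherent_minus)
qed

lemma nat_seq_class: "[(k::nat)] \<cdot>\<^bsub>C\<^esub> \<one>\<^bsub>C\<^esub> = seq_class (\<lambda>_. [k] \<cdot> \<one>)"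
  by (induction k) (simp_all add: one_C zero_C add_seq_class coherent_const)

section \<open>The filtration of the completion by completed powers\<close>

lemma completed_power_eq_kernel:
  "completed_power A I n = a_kernel C (A Quot J n) (\<lambda>x. x n)" (is "_ = ?K")
proof -
  have K: "?K = {x \<in> carrier C. x n = J n}"
    by (simp add: a_kernel_def' FactRing_def)
  \<comment> \<open>The condition on all components from \<open>n\<close> on collapses to the one at
    \<open>n\<close>: later representatives differ from \<open>a n\<close> by elements of
    \<open>J n\<close>.\<close>
  have "seq_class a \<in> completed_power A I n \<longleftrightarrow> seq_class a \<in> ?K" if a: "coherent a" for a
  proof
    assume "seq_class a \<in> completed_power A I n"
    then obtain b where "b \<in> J n" "J n +> a n = J n +> b"
      by (auto simp: completed_power_def seq_class_def)
    then show "seq_class a \<in> ?K"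
      using seq_class_closed[OF a] J_carr coset_eq_J_iff by (simp add: K seq_class_def)
  next
    assume "seq_class a \<in> ?K"
    then have "a n \<in> J n"
      using a coset_eq_J_iff by (simp add: K seq_class_def)
    then have "a m \<in> J n" if "n \<le> m" for m
    proof -
      have "a m = (a m \<ominus> a n) \<oplus> a n"
        using coherent_carr[OF a] by (simp add: minus_eq a_assoc l_neg)
      then show ?thesis using J_add[OF coherent_le[OF a that] \<open>a n \<in> J n\<close>] by simp
    qed
    then show "seq_class a \<in> completed_power A I n"
      using seq_class_closed[OF a] by (auto simp: completed_power_def seq_class_def)
  qed
  then have "x \<in> completed_power A I n \<longleftrightarrow> x \<in> ?K" if "x \<in> carrier C" for x
    using carrier_C_cases[OF that] by metis
  moreover have "completed_power A I n \<subseteq> carrier C" "?K \<subseteq> carrier C"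
    by (auto simp: completed_power_def K)
  ultimately show ?thesis by blast
qed

lemma completed_power_iff:
  "x \<in> completed_power A I n \<longleftrightarrow> x \<in> carrier C \<and> x n = J n"
  by (simp add: completed_power_eq_kernel a_kernel_def' FactRing_def)

lemma seq_class_completed_power_iff:
  assumes "coherent a"
  shows "seq_class a \<in> completed_power A I n \<longleftrightarrow> a n \<in> J n"
  using assms coset_eq_J_iff
  by (simp add: completed_power_iff seq_class_closed) (simp add: seq_class_def)

lemma ideal_completed_power: "ideal (completed_power A I n) C"
proof -
  interpret ring_hom_ring C "A Quot J n" "\<lambda>x. x n"
    using proj_hom ideal.quotient_is_ring[OF ideal_J] by (intro ring_hom_ringI2 C.ring_axioms)
  show ?thesis unfolding completed_power_eq_kernel by (rule kernel_is_ideal)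
qed

lemma coherent_mem_antimono:
  assumes "coherent a" "a m \<in> J m" "n \<le> m"
  shows "a n \<in> J n"
proof -
  have "a n = a m \<ominus> (a m \<ominus> a n)"
    using coherent_carr[OF assms(1), of m] coherent_carr[OF assms(1), of n] by algebra
  then show ?thesis
    using J_minus[OF J_mono[OF assms(2,3)] coherent_le[OF assms(1,3)]] by simp
qed

lemma decreasing_completed_power: "decreasing_ideals C (completed_power A I)"
  unfolding decreasing_ideals_def
proof (intro conjI allI impI subsetI)
  fix n x assume x: "x \<in> completed_power A I (Suc n)"
  then obtain a where a: "coherent a" "x = seq_class a"
    using carrier_C_cases by (metis completed_power_iff)
  with x show "x \<in> completed_power A I n"
    using coherent_mem_antimono[OF a(1), of "Suc n" n] by (simp only: seq_class_completed_power_iff)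
qed (rule ideal_completed_power)

lemma completed_power_mult:
  "completed_power A I m \<cdot>\<^bsub>C\<^esub> completed_power A I n \<subseteq> completed_power A I (m + n)"
proof
  fix x assume "x \<in> completed_power A I m \<cdot>\<^bsub>C\<^esub> completed_power A I n"
  then show "x \<in> completed_power A I (m + n)"
  proof (induction rule: ideal_prod.induct)
    case (prod x y)
    then obtain a b where a: "coherent a" "x = seq_class a" and b: "coherent b" "y = seq_class b"
      using carrier_C_cases by (metis completed_power_iff)
    \<comment> \<open>The factors need representatives in \<open>J m\<close> and \<open>J n\<close>
      at the common level \<open>m + n\<close>, which the definition of
      \<open>completed_power\<close> provides; their product then vanishes at that level.\<close>
    have "x (m + n) \<in> (\<lambda>a. J (m + n) +> a) ` J m" "y (m + n) \<in> (\<lambda>a. J (m + n) +> a) ` J n"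
      using prod by (auto simp: completed_power_def)
    then obtain c d where c: "c \<in> J m" "x (m + n) = J (m + n) +> c"
      and d: "d \<in> J n" "y (m + n) = J (m + n) +> d" by blast
    have "(x \<otimes>\<^bsub>C\<^esub> y) (m + n) = J (m + n) +> (c \<otimes> d)"
      using c d J_carr[OF c(1)] J_carr[OF d(1)] ideal.rcoset_mult_add[OF ideal_J]
      by (simp add: adic_completion_def FactRing_def)
    also have "\<dots> = J (m + n)"
      using J_mult[OF c(1) d(1)] J_carr[OF c(1)] J_carr[OF d(1)] by (simp add: coset_eq_J_iff)
    finally show ?case
      using prod by (simp add: completed_power_iff)
  next
    case (sum x y)
    then show ?case
      using ideal_completed_power by (simp add: additive_subgroup.a_closed ideal.axioms(1))
  qed
qed

lemma Inter_completed_power: "(\<Inter>n\<in>{1..}. completed_power A I n) \<subseteq> {\<zero>\<^bsub>C\<^esub>}"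
proof
  fix x assume x: "x \<in> (\<Inter>n\<in>{1..}. completed_power A I n)"
  then have "x \<in> carrier C" by (auto simp: completed_power_iff)
  then obtain a where a: "coherent a" "x = seq_class a" by (rule carrier_C_cases)
  have "a n \<in> J n" for n
  proof -
    \<comment> \<open>The intersection starts at index 1, whereas the claim includes
      \<open>n = 0\<close>; hence the detour through \<open>Suc n\<close>.\<close>
    have "x \<in> completed_power A I (Suc n)" by (rule INT_D[OF x]) simp
    then have "a (Suc n) \<in> J (Suc n)" using a by (simp only: seq_class_completed_power_iff)
    then show ?thesis by (rule coherent_mem_antimono[OF a(1)]) simp
  qed
  then have "x = seq_class (\<lambda>_. \<zero>)"
    using a by (simp add: seq_class_eq_iff coherent_const minus_eq)
  then show "x \<in> {\<zero>\<^bsub>C\<^esub>}" by (simp add: zero_C)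
qed

text \<open>Translates closeness in the filtration into equality of a component, so a Cauchy
  sequence becomes one whose components stabilise.\<close>

lemma diff_mem_completed_power_iff:
  assumes "x \<in> carrier C" "y \<in> carrier C"
  shows "x \<ominus>\<^bsub>C\<^esub> y \<in> completed_power A I n \<longleftrightarrow> x n = y n"
proof -
  obtain a b where a: "coherent a" "x = seq_class a" and b: "coherent b" "y = seq_class b"
    using assms carrier_C_cases by metis
  have "x \<ominus>\<^bsub>C\<^esub> y \<in> completed_power A I n \<longleftrightarrow> a n \<ominus> b n \<in> J n"
  proof -
    have "coherent (\<lambda>n. a n \<ominus> b n)"
      using a b by (simp add: minus_eq coherent_intros)
    then show ?thesis using a b by (simp add: minus_seq_class seq_class_completed_power_iff)
  qed
  also have "\<dots> \<longleftrightarrow> x n = y n"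
    using a b by (simp add: seq_class_def coset_eq_iff)
  finally show ?thesis .
qed

lemma ideals_complete_completed_power: "ideals_complete C (completed_power A I)"
  unfolding ideals_complete_def
proof (intro allI impI)
  fix s assume s: "ideals_Cauchy C (completed_power A I) s"
  then have sC: "s n \<in> carrier C" for n by (auto simp: ideals_Cauchy_def)
  have "\<exists>N. \<forall>m\<ge>N. s m i = s N i" if "i \<ge> 1" for i
    using s that sC unfolding ideals_Cauchy_def
    by (simp add: diff_mem_completed_power_iff) (metis order.refl)
  then obtain N where N: "s m i = s (N i) i" if "i \<ge> 1" "m \<ge> N i" for i m by metis
  \<comment> \<open>The Cauchy condition controls only indices from 1 on; component 0 is always the
    single coset of the unit ideal.\<close>
  have s0: "s m 0 = carrier A" for m
  proof -
    obtain a where a: "coherent a" "s m = seq_class a" using sC carrier_C_cases by metis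
    have "J 0 +> a 0 = J 0" using a by (simp only: coset_eq_J_iff coherent_carr) simp
    then show ?thesis using a by (simp add: seq_class_def)
  qed
  define l where "l i = s (N i) i" for i
  \<comment> \<open>The limit consists of the eventual values of the components. Two of them are
    compatible because both are read off from one term far enough along the sequence.\<close>
  have l: "s m i = l i" if "m \<ge> N i" for m i
    using N[of i m] s0 that by (cases "i = 0") (auto simp: l_def)
  have "l \<in> carrier C"
    unfolding adic_completion_def
  proof (simp, intro conjI allI impI)
    fix i show "l i \<in> carrier (A Quot J i)"
      using sC[of "N i"] by (simp add: l_def adic_completion_def)
  next
    fix i j :: nat assume "i \<le> j"
    define m where "m = max (N i) (N j)"
    have "s m j <+> J i = s m i"
      using sC[of m] \<open>i \<le> j\<close> by (simp add: adic_completion_def)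
    then show "l j <+> J i = l i" using l[of i m] l[of j m] by (simp add: m_def)
  qed
  moreover have "eventually (\<lambda>n. s n \<ominus>\<^bsub>C\<^esub> l \<in> completed_power A I i) sequentially" for i
    unfolding eventually_sequentially using l sC \<open>l \<in> carrier C\<close>
    by (auto simp: diff_mem_completed_power_iff)
  ultimately have "limitin (ideals_topology C (completed_power A I)) s l sequentially"
    using sC by (intro limitin_ideals_topology decreasing_completed_power) auto
  then show "\<exists>l. limitin (ideals_topology C (completed_power A I)) s l sequentially" by blast
qed

end

section \<open>Completion along a lift of Frobenius\<close>

lemma (in cring) add_pow_one_power:
  "[(m ^ k :: nat)] \<cdot> \<one> = ([m] \<cdot> \<one>) [^] k"
proof (induction k)
  case (Suc k)
  have "[(m ^ Suc k)] \<cdot> \<one> = [m] \<cdot> ([(m ^ k)] \<cdot> \<one>)"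
    by (simp add: add.nat_pow_pow mult.commute)
  also have "\<dots> = ([(m ^ k)] \<cdot> \<one>) \<otimes> ([m] \<cdot> \<one>)"
    by (simp add: add_pow_rdistr del: add.nat_pow_pow)
  finally show ?case using Suc by simp
qed simp

lemma (in ring_hom_cring) hom_nat:
  "h ([(n::nat)] \<cdot> \<one>) = [n] \<cdot>\<^bsub>S\<^esub> \<one>\<^bsub>S\<^esub>"
  by (induction n) auto

text \<open>The multiple of one is the image of the integer \<open>p\<close> under the maps from the
  integers to \<open>ZFact (int p)\<close> and on to \<open>R\<close>, and the first of them kills
  it.\<close>

lemma Fp_algebra_char:
  assumes "Fp_algebra p R"
  shows "[p] \<cdot>\<^bsub>R\<^esub> \<one>\<^bsub>R\<^esub> = \<zero>\<^bsub>R\<^esub>"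
proof -
  obtain h where h: "h \<in> ring_hom (ZFact (int p)) R" and R: "cring R"
    using assms by (auto simp: Fp_algebra_def)
  interpret I: ideal "Idl\<^bsub>\<Z>\<^esub> {int p}" \<Z> by (rule int.genideal_ideal) simp
  interpret q: ring_hom_cring \<Z> "ZFact (int p)" "(+>\<^bsub>\<Z>\<^esub>) (Idl\<^bsub>\<Z>\<^esub> {int p})"
    unfolding ZFact_def by (rule I.rcos_ring_hom_cring) (rule int.cring_axioms)
  interpret R: cring R by fact
  interpret h: ring_hom_cring "ZFact (int p)" R h
    using h by unfold_locales
  have Z: "[n] \<cdot>\<^bsub>\<Z>\<^esub> (1::int) = int n" for n :: nat
    by (induction n) (simp_all add: int.add.nat_pow_Suc)
  have "[p] \<cdot>\<^bsub>R\<^esub> \<one>\<^bsub>R\<^esub> = h ((Idl\<^bsub>\<Z>\<^esub> {int p}) +>\<^bsub>\<Z>\<^esub> int p)"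
    using q.hom_nat[of p] h.hom_nat[of p] by (simp only: Z)
  also have "(Idl\<^bsub>\<Z>\<^esub> {int p}) +>\<^bsub>\<Z>\<^esub> int p = \<zero>\<^bsub>ZFact (int p)\<^esub>"
  proof -
    have "int p \<in> Idl\<^bsub>\<Z>\<^esub> {int p}" by (rule int.genideal_self') simp
    then have "(Idl\<^bsub>\<Z>\<^esub> {int p}) +>\<^bsub>\<Z>\<^esub> int p = Idl\<^bsub>\<Z>\<^esub> {int p}" by (rule I.a_rcos_const)
    then show ?thesis by (simp only: ZFact_def FactRing_def ring.simps)
  qed
  finally show ?thesis by simp
qed

lemma perfect_Fp_algebra_iso:
  assumes "cring S" "h \<in> ring_iso S R" "perfect_Fp_algebra p R"
  shows "perfect_Fp_algebra p S"
proof -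
  interpret S: cring S by fact
  have R: "cring R" "ring_hom (ZFact (int p)) R \<noteq> {}"
    and frob: "(\<lambda>x. x [^]\<^bsub>R\<^esub> p) \<in> ring_iso R R"
    using assms(3) by (auto simp: perfect_Fp_algebra_def Fp_algebra_def)
  interpret R: cring R by fact
  define g where "g = inv_into (carrier S) h"
  have g: "g \<in> ring_iso R S"
    unfolding g_def by (rule ring_iso_set_sym[OF S.ring_axioms assms(2)])
  interpret h: ring_hom_cring S R h
    using assms(2) by unfold_locales (simp add: ring_iso_def)
  obtain f where "f \<in> ring_hom (ZFact (int p)) R" using R by blast
  then have "g \<circ> f \<in> ring_hom (ZFact (int p)) S"
    using g by (auto simp: ring_iso_def intro: ring_hom_trans)
  moreover have "(\<lambda>x. x [^]\<^bsub>S\<^esub> p) \<in> ring_iso S S"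
  \<comment> \<open>Frobenius of \<open>S\<close> is the conjugate of Frobenius of \<open>R\<close>
    by \<open>h\<close>. The two functions agree only on the carrier, hence the restriction
    rule.\<close>
  proof (rule S.ring_iso_restrict)
    show "g \<circ> ((\<lambda>x. x [^]\<^bsub>R\<^esub> p) \<circ> h) \<in> ring_iso S S"
      by (intro ring_iso_set_trans[OF _ g] ring_iso_set_trans[OF assms(2) frob])
    fix x assume x: "x \<in> carrier S"
    have "h x [^]\<^bsub>R\<^esub> p = h (x [^]\<^bsub>S\<^esub> p)"
      using x by (simp add: h.ring.hom_nat_pow)
    moreover have "g (h (x [^]\<^bsub>S\<^esub> p)) = x [^]\<^bsub>S\<^esub> p"
      using assms(2) x unfolding g_def ring_iso_def bij_betw_def
      by (intro inv_into_f_f) simp_all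
    ultimately show "(g \<circ> ((\<lambda>x. x [^]\<^bsub>R\<^esub> p) \<circ> h)) x = x [^]\<^bsub>S\<^esub> p" by simp
  qed
  ultimately show ?thesis
    using assms(1) by (auto simp: perfect_Fp_algebra_def Fp_algebra_def)
qed

section \<open>Multiplication by \<open>p\<close> on the completion\<close>

context frobenius_lift
begin

lemma nat_seq_class_p: "[(p ^ i)] \<cdot>\<^bsub>C\<^esub> \<one>\<^bsub>C\<^esub> = seq_class (\<lambda>_. P [^] i)"
  by (simp add: nat_seq_class add_pow_one_power)

lemma completed_power_divisible:
  assumes "x \<in> completed_power A I i"
  shows "\<exists>y\<in>carrier C. x = y \<otimes>\<^bsub>C\<^esub> ([(p ^ i)] \<cdot>\<^bsub>C\<^esub> \<one>\<^bsub>C\<^esub>)"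
proof -
  obtain a where a: "coherent a" "x = seq_class a"
    using assms carrier_C_cases by (metis completed_power_iff)
  have ai: "a i \<in> J i" using assms a by (simp only: seq_class_completed_power_iff)
  note ac = coherent_carr[OF a(1)]
  have "a (i + n) \<in> J i" for n
  proof -
    have "a (i + n) = (a (i + n) \<ominus> a i) \<oplus> a i"
      using ac by (simp add: minus_eq a_assoc l_neg)
    then show ?thesis using J_add[OF coherent_le[OF a(1)] ai, of "i + n"] by simp
  qed
  \<comment> \<open>The terms are shifted by \<open>i\<close> because cancelling
    \<open>P [^] i\<close> costs \<open>i\<close> steps of the filtration: a remainder in
    \<open>J (i + n)\<close> leaves the quotients \<open>b\<close> coherent at level
    \<open>n\<close>.\<close>
  then have "\<exists>b y. b \<in> carrier A \<and> y \<in> J (i + n) \<and> a (i + n) = y \<oplus> P [^] i \<otimes> b" for n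
    using ideal_power_decomp by blast
  then obtain b y where bd: "b n \<in> carrier A" "y n \<in> J (i + n)" "a (i + n) = y n \<oplus> P [^] i \<otimes> b n" for n
    by metis
  note yc = J_carr[OF bd(2)]
  have Pi: "P [^] i \<in> carrier A" by (rule nat_pow_closed) simp
  have b: "coherent b"
  proof (rule coherentI)
    fix n
    have "P [^] i \<otimes> (b (Suc n) \<ominus> b n) = (a (i + Suc n) \<ominus> a (i + n)) \<ominus> (y (Suc n) \<ominus> y n)"
      unfolding bd(3) using Pi bd(1)[of n] bd(1)[of "Suc n"] yc[of n] yc[of "Suc n"] by algebra
    moreover have "a (i + Suc n) \<ominus> a (i + n) \<in> J (i + n)"
      using coherent_step[OF a(1), of "i + n"] by simp
    moreover have "y (Suc n) \<ominus> y n \<in> J (i + n)"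
      by (intro J_minus J_mono[OF bd(2)[of "Suc n"]] bd(2)) simp
    ultimately have "P [^] i \<otimes> (b (Suc n) \<ominus> b n) \<in> J (n + i)"
      using J_minus by (simp add: add.commute)
    then show "b (Suc n) \<ominus> b n \<in> J n"
      by (intro ideal_power_cancel_p_pow[of _ i n]) (simp_all add: bd(1))
  qed (rule bd(1))
  \<comment> \<open>The shift is undone here: \<open>a (i + n)\<close> and \<open>a n\<close> agree
    modulo \<open>J n\<close>, and the remainder \<open>y n\<close> lies there too.\<close>
  have "a n \<ominus> b n \<otimes> P [^] i \<in> J n" for n
  proof -
    have "a n \<ominus> b n \<otimes> P [^] i = y n \<ominus> (a (i + n) \<ominus> a n)"
      unfolding bd(3) using Pi bd(1)[of n] yc[of n] ac[of n] by algebra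
    moreover have "y n \<in> J n" by (rule J_mono[OF bd(2)]) simp
    ultimately show ?thesis using J_minus coherent_le[OF a(1), of n "i + n"] by simp
  qed
  then have "x = seq_class (\<lambda>n. b n \<otimes> P [^] i)"
    using a b Pi by (simp add: seq_class_eq_iff coherent_mult coherent_const)
  also have "\<dots> = seq_class b \<otimes>\<^bsub>C\<^esub> ([(p ^ i)] \<cdot>\<^bsub>C\<^esub> \<one>\<^bsub>C\<^esub>)"
    using b Pi by (simp only: nat_seq_class_p mult_seq_class coherent_const)
  finally show ?thesis using seq_class_closed[OF b] by blast
qed

lemma completed_power_eq_nat_ideal: "completed_power A I i = nat_ideal C (p ^ i)"
proof
  show "completed_power A I i \<subseteq> nat_ideal C (p ^ i)"
    using completed_power_divisible by (auto simp: nat_ideal_def cgenideal_def)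
  have Pi: "P [^] i \<in> carrier A" by (rule nat_pow_closed) simp
  have "[(p ^ i)] \<cdot>\<^bsub>C\<^esub> \<one>\<^bsub>C\<^esub> \<in> completed_power A I i"
    unfolding nat_seq_class_p seq_class_completed_power_iff[OF coherent_const[OF Pi]]
    by (rule ideal_power_pow_mem[OF is_ideal p_mem])
  then show "nat_ideal C (p ^ i) \<subseteq> completed_power A I i"
    unfolding nat_ideal_def by (rule C.cgenideal_minimal[OF ideal_completed_power])
qed

text \<open>Cancelling \<open>p\<close> in \<open>A\<close> loses one step, which is harmless in the
  limit: \<open>a (Suc n)\<close> lies in \<open>J n\<close> and represents the same class there as
  \<open>a n\<close>.\<close>

lemma p_cancel_C:
  assumes "x \<in> carrier C" "([p] \<cdot>\<^bsub>C\<^esub> \<one>\<^bsub>C\<^esub>) \<otimes>\<^bsub>C\<^esub> x = \<zero>\<^bsub>C\<^esub>"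
  shows "x = \<zero>\<^bsub>C\<^esub>"
proof -
  obtain a where a: "coherent a" "x = seq_class a" using assms(1) by (rule carrier_C_cases)
  note ac = coherent_carr[OF a(1)]
  have "seq_class (\<lambda>n. P \<otimes> a n) = seq_class (\<lambda>_. \<zero>)"
    using assms(2) a by (simp add: nat_seq_class mult_seq_class coherent_const zero_C)
  then have "P \<otimes> a n \<ominus> \<zero> \<in> J n" for n
    using a by (simp only: seq_class_eq_iff coherent_const coherent_mult P_carr add.one_closed)
  then have "P \<otimes> a n \<in> J n" for n
    using ac by (simp add: minus_eq)
  then have "a (Suc n) \<in> J n" for n
    by (rule ideal_power_cancel_p[OF ac])
  moreover have "a n = a (Suc n) \<ominus> (a (Suc n) \<ominus> a n)" for n
    using ac[of n] ac[of "Suc n"] by algebra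
  ultimately have "a n \<in> J n" for n
    using J_minus[OF _ coherent_step[OF a(1)], of "a (Suc n)" n] by simp
  then show ?thesis
    using a ac by (simp add: zero_C seq_class_eq_iff coherent_const minus_eq)
qed

end

section \<open>The residue ring of the completion\<close>

locale frobenius_lift_residue =
  frobenius_lift A I p F G + residue: ring_hom_cring A R \<pi>
  for A (structure) and I p F G and R (structure) and \<pi> +
  assumes perfect: "perfect_Fp_algebra p R"
    and kernel: "I = a_kernel A R \<pi>"
    and surj: "\<pi> ` carrier A = carrier R"
begin

text \<open>For \<open>x\<close> in the completion, \<open>x 1\<close> is a coset of the kernel of
  \<pi>, so its image is a singleton. With evaluation as \<pi> this is
  \<open>C_proj\<close>.\<close>

definition proj
  where "proj x = the_elem (\<pi> ` x (1::nat))"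

lemma proj_seq_class:
  assumes "coherent a"
  shows "proj (seq_class a) = \<pi> (a 1)"
  using residue.ring.the_elem_simp[of "a 1"] coherent_carr[OF assms] ideal_power_1[OF is_ideal]
  by (simp add: proj_def seq_class_def kernel[symmetric])

lemma proj_ring_hom: "proj \<in> ring_hom C R"
proof -
  have "(\<lambda>Y. the_elem (\<pi> ` Y)) \<in> ring_hom (A Quot J 1) R"
    using residue.ring.the_elem_hom ideal_power_1[OF is_ideal] by (simp add: kernel[symmetric])
  from ring_hom_trans[OF proj_hom this] show ?thesis
    by (simp add: comp_def proj_def[abs_def])
qed

sublocale proj: ring_hom_cring C R proj
  using proj_ring_hom by unfold_locales

lemma proj_kernel: "a_kernel C R proj = completed_power A I 1"
proof -
  have "proj x = \<zero>\<^bsub>R\<^esub> \<longleftrightarrow> x \<in> completed_power A I 1" if x: "x \<in> carrier C" for x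
  proof -
    obtain a where a: "coherent a" "x = seq_class a" using x by (rule carrier_C_cases)
    have "proj x = \<zero>\<^bsub>R\<^esub> \<longleftrightarrow> a 1 \<in> I"
    proof -
      have "a 1 \<in> a_kernel A R \<pi> \<longleftrightarrow> \<pi> (a 1) = \<zero>\<^bsub>R\<^esub>"
        unfolding a_kernel_def' mem_Collect_eq by (simp only: coherent_carr[OF a(1)] simp_thms)
      then show ?thesis unfolding kernel[symmetric] a(2) proj_seq_class[OF a(1)] by (rule sym)
    qed
    also have "\<dots> \<longleftrightarrow> x \<in> completed_power A I 1"
      using a ideal_power_1[OF is_ideal] by (simp only: seq_class_completed_power_iff One_nat_def)
    finally show ?thesis .
  qed
  moreover have "completed_power A I 1 \<subseteq> carrier C"
    using completed_power_iff by blast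
  ultimately show ?thesis unfolding a_kernel_def' by blast
qed

lemma proj_surj: "proj ` carrier C = carrier R"
proof
  show "carrier R \<subseteq> proj ` carrier C"
  proof
    fix r assume "r \<in> carrier R"
    then obtain a where a: "a \<in> carrier A" "r = \<pi> a" using surj by blast
    then have "r = proj (seq_class (\<lambda>_. a))" by (simp add: proj_seq_class coherent_const)
    then show "r \<in> proj ` carrier C" using seq_class_closed[OF coherent_const[OF a(1)]] by blast
  qed
qed auto

lemma residue_iso:
  "(\<lambda>Y. the_elem (proj ` Y)) \<in> ring_iso (C Quot completed_power A I 1) R"
  using proj.ring.FactRing_iso_set[OF proj_surj] by (simp only: proj_kernel)

lemma residue_iso_coset:
  "x \<in> carrier C \<Longrightarrow> the_elem (proj ` (completed_power A I 1 +>\<^bsub>C\<^esub> x)) = proj x"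
  using proj.ring.the_elem_simp by (simp only: proj_kernel)

lemma strict_p_ring_completion: "strict_p_ring p C (completed_power A I)"
proof -
  have "perfect_Fp_algebra p (C Quot completed_power A I 1)"
    using ideal.quotient_is_cring[OF ideal_completed_power cring_C] residue_iso perfect
    by (rule perfect_Fp_algebra_iso)
  then show ?thesis
    unfolding strict_p_ring_def p_ring_def
    using cring_C decreasing_completed_power ideals_complete_completed_power
      Hausdorff_space_ideals_topology[OF decreasing_completed_power Inter_completed_power]
      completed_power_mult completed_power_eq_nat_ideal p_cancel_C by blast
qed

end

section \<open>The monoid algebra\<close>

text \<open>Needed for additivity of the product in its second factor, which sits inside the
  function being extended.\<close>

lemma frag_extend_fun_diff:
  "frag_extend (\<lambda>r. f r - g r) c = frag_extend f c - frag_extend g c"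
  using subset_UNIV by (induction c rule: frag_induction) (auto simp: frag_extend_diff)

lemma frag_extend_fun_zero: "frag_extend (\<lambda>r. 0) c = 0"
  by (simp add: frag_extend_eq_0)

lemma frag_extend_mem:
  assumes "Poly_Mapping.keys c \<subseteq> S" "\<And>r. r \<in> S \<Longrightarrow> Poly_Mapping.keys (f r) \<subseteq> T"
  shows "Poly_Mapping.keys (frag_extend f c) \<subseteq> T"
  using keys_frag_extend[of f c] assms by blast

section \<open>The ring structure on formal sums\<close>

context comm_monoid
begin

abbreviation M where "M \<equiv> monoid_algebra G"

lemma carrier_M: "carrier M = {c. Poly_Mapping.keys c \<subseteq> carrier G}"
  by (simp add: monoid_algebra_def)

lemma frag_of_carrier [simp]: "r \<in> carrier G \<Longrightarrow> frag_of r \<in> carrier M"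
  by (simp add: carrier_M)

lemma one_M: "\<one>\<^bsub>M\<^esub> = frag_of \<one>" and zero_M [simp]: "\<zero>\<^bsub>M\<^esub> = 0"
  and add_M [simp]: "c \<oplus>\<^bsub>M\<^esub> d = c + d"
  by (simp_all add: monoid_algebra_def)

lemma mult_M:
  "c \<otimes>\<^bsub>M\<^esub> d = frag_extend (\<lambda>r. frag_extend (\<lambda>s. frag_of (r \<otimes> s)) d) c"
  by (simp add: monoid_algebra_def)

lemma mult_M_frag_of [simp]: "frag_of r \<otimes>\<^bsub>M\<^esub> frag_of s = frag_of (r \<otimes> s)"
  by (simp add: mult_M)

lemma mult_M_diff:
  "(a - b) \<otimes>\<^bsub>M\<^esub> d = a \<otimes>\<^bsub>M\<^esub> d - b \<otimes>\<^bsub>M\<^esub> d"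
  "d \<otimes>\<^bsub>M\<^esub> (a - b) = d \<otimes>\<^bsub>M\<^esub> a - d \<otimes>\<^bsub>M\<^esub> b"
  by (simp_all add: mult_M frag_extend_diff frag_extend_fun_diff)

lemma mult_M_zero: "0 \<otimes>\<^bsub>M\<^esub> d = 0" "d \<otimes>\<^bsub>M\<^esub> 0 = 0"
  using mult_M_diff[of d d d] by (simp_all add: mult_M frag_extend_fun_zero)

text \<open>Basis elements generate all formal sums under subtraction, so biadditive identities
  reduce to the monoid.\<close>

lemma M_induct [consumes 1, case_names zero frag_of diff]:
  assumes "c \<in> carrier M" "P 0" "\<And>r. r \<in> carrier G \<Longrightarrow> P (frag_of r)"
    "\<And>a b. P a \<Longrightarrow> P b \<Longrightarrow> P (a - b)"
  shows "P c"
  using assms by (intro frag_induction[of c "carrier G" P]) (auto simp: carrier_M)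

lemma M_add_closed: "c \<in> carrier M \<Longrightarrow> d \<in> carrier M \<Longrightarrow> c + d \<in> carrier M"
  using keys_add[of c d] by (auto simp: carrier_M)

lemma M_uminus_closed: "c \<in> carrier M \<Longrightarrow> - c \<in> carrier M"
  by (simp add: carrier_M)

lemma M_mult_closed: "c \<in> carrier M \<Longrightarrow> d \<in> carrier M \<Longrightarrow> c \<otimes>\<^bsub>M\<^esub> d \<in> carrier M"
  unfolding mult_M carrier_M mem_Collect_eq
  by (intro frag_extend_mem[of c "carrier G"] frag_extend_mem[of d "carrier G"]) auto

lemma M_mult_comm:
  assumes "c \<in> carrier M" "d \<in> carrier M"
  shows "c \<otimes>\<^bsub>M\<^esub> d = d \<otimes>\<^bsub>M\<^esub> c"
  using assms(1)
proof (induction c rule: M_induct)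
  case (frag_of r)
  from assms(2) show ?case
    by (induction d rule: M_induct) (simp_all add: mult_M_zero mult_M_diff frag_of m_comm)
qed (simp_all add: mult_M_zero mult_M_diff)

lemma M_mult_assoc:
  assumes "c \<in> carrier M" "d \<in> carrier M" "e \<in> carrier M"
  shows "(c \<otimes>\<^bsub>M\<^esub> d) \<otimes>\<^bsub>M\<^esub> e = c \<otimes>\<^bsub>M\<^esub> (d \<otimes>\<^bsub>M\<^esub> e)"
  using assms(1)
proof (induction c rule: M_induct)
  case (frag_of r)
  from assms(2) show ?case
  proof (induction d rule: M_induct)
    case (frag_of s)
    from assms(3) show ?case
      by (induction e rule: M_induct)
        (simp_all add: mult_M_zero mult_M_diff frag_of \<open>r \<in> carrier G\<close> m_assoc)
  qed (simp_all add: mult_M_zero mult_M_diff)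
qed (simp_all add: mult_M_zero mult_M_diff)

lemma M_one_mult:
  assumes "c \<in> carrier M"
  shows "\<one>\<^bsub>M\<^esub> \<otimes>\<^bsub>M\<^esub> c = c"
  using assms by (induction c rule: M_induct) (simp_all add: one_M mult_M_zero mult_M_diff)

lemma cring_M: "cring M"
proof (rule cringI)
  show "abelian_group M"
  proof (rule abelian_groupI)
    fix x assume "x \<in> carrier M"
    then show "\<exists>y\<in>carrier M. y \<oplus>\<^bsub>M\<^esub> x = \<zero>\<^bsub>M\<^esub>"
      using M_uminus_closed[of x] by (intro bexI[of _ "- x"]) auto
  qed (simp_all add: M_add_closed algebra_simps, simp add: carrier_M)
  show "comm_monoid M"
    by (intro comm_monoidI M_mult_closed M_mult_assoc M_one_mult M_mult_comm) (simp_all add: one_M)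
  fix x y z
  \<comment> \<open>The sum is written as a double difference to derive distributivity from the
    rules for differences.\<close>
  have "(x - (0 - y)) \<otimes>\<^bsub>M\<^esub> z = x \<otimes>\<^bsub>M\<^esub> z - (0 \<otimes>\<^bsub>M\<^esub> z - y \<otimes>\<^bsub>M\<^esub> z)"
    by (simp only: mult_M_diff)
  then show "(x \<oplus>\<^bsub>M\<^esub> y) \<otimes>\<^bsub>M\<^esub> z = x \<otimes>\<^bsub>M\<^esub> z \<oplus>\<^bsub>M\<^esub> y \<otimes>\<^bsub>M\<^esub> z"
    by (simp add: mult_M_zero)
qed

lemma M_uminus:
  assumes "c \<in> carrier M"
  shows "\<ominus>\<^bsub>M\<^esub> c = - c"
proof -
  interpret M: cring M by (rule cring_M)
  show ?thesis using assms by (intro M.minus_equality) (auto simp: M_uminus_closed)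
qed

lemma M_add_pow: "[(n::nat)] \<cdot>\<^bsub>M\<^esub> c = frag_cmul (int n) c"
proof -
  interpret M: cring M by (rule cring_M)
  show ?thesis
    by (induction n) (simp_all add: frag_cmul_distrib add.commute)
qed

text \<open>For a monoid endomorphism \<open>f\<close> this is the induced ring endomorphism; the
  p-th power map yields the lift of Frobenius.\<close>

definition M_map :: "('a \<Rightarrow> 'a) \<Rightarrow> ('a \<Rightarrow>\<^sub>0 int) \<Rightarrow> ('a \<Rightarrow>\<^sub>0 int)"
  where "M_map f = frag_extend (\<lambda>r. frag_of (f r))"

lemma M_map_simps [simp]:
  "M_map f 0 = 0" "M_map f (frag_of r) = frag_of (f r)"
  "M_map f (a - b) = M_map f a - M_map f b" "M_map f (a + b) = M_map f a + M_map f b"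
  by (simp_all add: M_map_def frag_extend_diff frag_extend_add)

lemma M_map_hom:
  assumes f: "f \<in> hom G G" "f \<one> = \<one>"
  shows "M_map f \<in> ring_hom M M"
proof (rule ring_hom_memI)
  have fc: "f r \<in> carrier G" if "r \<in> carrier G" for r using f(1) that by (auto simp: hom_def)
  fix c d assume c: "c \<in> carrier M" and d: "d \<in> carrier M"
  show "M_map f c \<in> carrier M"
    using c unfolding M_map_def carrier_M mem_Collect_eq
    by (rule frag_extend_mem) (simp add: fc)
  show "M_map f (c \<otimes>\<^bsub>M\<^esub> d) = M_map f c \<otimes>\<^bsub>M\<^esub> M_map f d"
    using c
  proof (induction c rule: M_induct)
    case (frag_of r)
    from d show ?case
      by (induction d rule: M_induct)
        (use f frag_of in \<open>simp_all add: mult_M_zero mult_M_diff hom_mult\<close>)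
  qed (simp_all add: mult_M_zero mult_M_diff)
qed (simp_all add: one_M f)

lemma M_map_inverse:
  assumes "\<And>r. r \<in> carrier G \<Longrightarrow> f (g r) = r" "c \<in> carrier M"
  shows "M_map f (M_map g c) = c"
  using assms(2) by (induction c rule: M_induct) (simp_all add: assms(1))

end

section \<open>Evaluation of formal sums\<close>

context cring
begin

text \<open>Different elements have different supports; extra terms with coefficient 0 allow their
  evaluations to be compared over one index set.\<close>

lemma eval_hom_superset:
  assumes "finite S" "S \<subseteq> carrier R" "Poly_Mapping.keys c \<subseteq> S"
  shows "eval_hom R c = (\<Oplus>r\<in>S. [Poly_Mapping.lookup c r] \<cdot> r)"
proof -
  have "[(0::int)] \<cdot> r = \<zero>" for r by (simp add: add_pow_def)
  with assms show ?thesis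
    unfolding eval_hom_def by (intro add.finprod_mono_neutral_cong_left) (auto simp: in_keys_iff)
qed

lemma eval_hom_frag_of [simp]:
  assumes "r \<in> carrier R"
  shows "eval_hom R (frag_of r) = r"
  using eval_hom_superset[of "{r}" "frag_of r"] assms by simp

lemma eval_hom_zero [simp]: "eval_hom R 0 = \<zero>"
  by (simp add: eval_hom_def)

lemma eval_hom_diff:
  assumes "c \<in> carrier M" "d \<in> carrier M"
  shows "eval_hom R (c - d) = eval_hom R c \<ominus> eval_hom R d"
proof -
  let ?S = "Poly_Mapping.keys c \<union> Poly_Mapping.keys d"
  have S: "finite ?S" "?S \<subseteq> carrier R" using assms by (auto simp: carrier_M)
  have *: "eval_hom R e = (\<Oplus>r\<in>?S. [Poly_Mapping.lookup e r] \<cdot> r)"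
    if "Poly_Mapping.keys e \<subseteq> ?S" for e
    using S that by (rule eval_hom_superset)
  have "Poly_Mapping.keys (c - d) \<subseteq> ?S" by (rule keys_diff)
  then have "eval_hom R (c - d) \<oplus> eval_hom R d
      = (\<Oplus>r\<in>?S. [Poly_Mapping.lookup (c - d) r] \<cdot> r \<oplus> [Poly_Mapping.lookup d r] \<cdot> r)"
    using S(2) by (subst (1 2) *) (auto intro!: add.finprod_multf[symmetric])
  also have "\<dots> = eval_hom R c"
    unfolding *[OF Un_upper1] using S(2)
    by (intro add.finprod_cong') (auto simp: lookup_minus simp flip: add.int_pow_mult)
  finally have sum: "eval_hom R (c - d) \<oplus> eval_hom R d = eval_hom R c" .
  have "eval_hom R e \<in> carrier R" if "Poly_Mapping.keys e \<subseteq> ?S" for e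
    unfolding *[OF that] using S(2) by (intro finsum_closed) auto
  from this[of "c - d"] this[of d] keys_diff[of c d] show ?thesis
    unfolding sum[symmetric] by (simp add: minus_eq a_assoc r_neg)
qed

lemma eval_hom_closed:
  assumes "c \<in> carrier M"
  shows "eval_hom R c \<in> carrier R"
  unfolding eval_hom_def using assms by (intro finsum_closed) (auto simp: carrier_M)

text \<open>Adds carrier membership to the difference case, where \<open>eval_hom_diff\<close>
  requires it.\<close>

lemma M_eval_induct [consumes 1, case_names zero frag_of diff]:
  assumes "c \<in> carrier M" "P 0" "\<And>r. r \<in> carrier R \<Longrightarrow> P (frag_of r)"
    "\<And>a b. a \<in> carrier M \<Longrightarrow> b \<in> carrier M \<Longrightarrow> P a \<Longrightarrow> P b \<Longrightarrow> P (a - b)"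
  shows "P c"
proof -
  have "c \<in> carrier M \<and> P c"
    using assms(1)
  proof (induction c rule: M_induct)
    case (diff a b)
    then show ?case
      using M_add_closed[of a "- b"] M_uminus_closed[of b] assms(4) by simp
  qed (use assms in \<open>auto simp: carrier_M\<close>)
  then show ?thesis ..
qed

lemma eval_hom_ring_hom: "eval_hom R \<in> ring_hom M R"
proof (rule ring_hom_memI)
  fix c d assume c: "c \<in> carrier M" and d: "d \<in> carrier M"
  show "eval_hom R c \<in> carrier R" using c by (rule eval_hom_closed)
  have "eval_hom R (c - (0 - d)) = eval_hom R c \<ominus> (\<zero> \<ominus> eval_hom R d)"
    using c d M_uminus_closed[OF d] by (subst eval_hom_diff | simp add: carrier_M)+
  then show "eval_hom R (c \<oplus>\<^bsub>M\<^esub> d) = eval_hom R c \<oplus> eval_hom R d"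
    using c d eval_hom_closed by (simp add: minus_eq)
  show "eval_hom R (c \<otimes>\<^bsub>M\<^esub> d) = eval_hom R c \<otimes> eval_hom R d"
    using c
  proof (induction c rule: M_eval_induct)
    case (frag_of r)
    from d show ?case
    proof (induction d rule: M_eval_induct)
      case (diff a b)
      then show ?case
        using frag_of eval_hom_closed
        by (simp add: mult_M_diff eval_hom_diff M_mult_closed minus_eq r_distr r_minus)
    qed (use frag_of in \<open>simp_all add: mult_M_zero\<close>)
  next
    case (diff a b)
    then show ?case
      using d eval_hom_closed
      by (simp add: mult_M_diff eval_hom_diff M_mult_closed minus_eq l_distr l_minus)
  qed (use d eval_hom_closed in \<open>simp_all add: mult_M_zero\<close>)
qed (simp add: one_M)

text \<open>Naturality of evaluation, which makes the induced maps preserve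
  \<open>eval_kernel\<close>. Both sides respect differences and agree on basis elements.\<close>

lemma eval_hom_M_map:
  assumes f: "f \<in> ring_hom R R" and c: "c \<in> carrier M"
  shows "eval_hom R (M_map f c) = f (eval_hom R c)"
proof -
  interpret f: ring_hom_cring R R f using f by unfold_locales
  have "M_map f a \<in> carrier M" if "a \<in> carrier M" for a
    using M_map_hom[of f] f that by (intro ring_hom_closed[of "M_map f" M M]) (auto simp: ring_hom_in_hom)
  with c show ?thesis
    by (induction c rule: M_eval_induct) (auto simp: eval_hom_diff eval_hom_closed minus_eq)
qed

end

lemma (in cring) frobenius_diff_aux:
  assumes "a \<in> carrier R" "n \<in> carrier R" "c \<in> carrier R"
    "u \<in> carrier R" "v \<in> carrier R" "w \<in> carrier R" "z \<in> carrier R"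
  shows "(a \<oplus> c \<otimes> z) \<ominus> (\<ominus> (n \<oplus> c \<otimes> u) \<oplus> c \<otimes> w)
    = (a \<oplus> n \<oplus> c \<otimes> v) \<oplus> c \<otimes> (u \<ominus> v \<oplus> z \<ominus> w)"
  using assms by algebra

text \<open>The congruence is an equality on basis elements, since [r]^p = [r^p], and the elements
  satisfying it are closed under subtraction because p-th powers are additive modulo
  \<open>p\<close>.\<close>

lemma (in comm_monoid) M_map_power_cong:
  assumes p: "Factorial_Ring.prime (p::nat)" and c: "c \<in> carrier M"
  shows "\<exists>z\<in>carrier M. M_map (\<lambda>r. r [^] p) c
    = c [^]\<^bsub>M\<^esub> p \<oplus>\<^bsub>M\<^esub> ([p] \<cdot>\<^bsub>M\<^esub> \<one>\<^bsub>M\<^esub>) \<otimes>\<^bsub>M\<^esub> z"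
    (is "\<exists>z\<in>carrier M. ?F c = ?E c z")
proof -
  interpret M: cring M by (rule cring_M)
  let ?P = "[p] \<cdot>\<^bsub>M\<^esub> \<one>\<^bsub>M\<^esub>"
  have P: "?P \<in> carrier M" by simp
  have zero_pow: "\<zero>\<^bsub>M\<^esub> [^]\<^bsub>M\<^esub> p = \<zero>\<^bsub>M\<^esub>"
    using prime_gt_0_nat[OF p] M.r_null[OF M.nat_pow_closed[OF M.zero_closed]]
    by (cases p) simp_all
  have "c \<in> carrier M \<and> (\<exists>z\<in>carrier M. ?F c = ?E c z)"
    using c
  proof (induction c rule: M_induct)
    case zero
    show ?case
      using zero_pow P by (intro conjI bexI[of _ "0"]) (simp_all add: mult_M_zero carrier_M)
  next
    case (frag_of r)
    have "(frag_of r) [^]\<^bsub>M\<^esub> n = frag_of (r [^] n)" for n :: nat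
      by (induction n) (simp_all add: one_M)
    then show ?case
      using frag_of by (intro conjI bexI[of _ "0"]) (simp_all add: mult_M_zero carrier_M)
  next
    case (diff a b)
    then obtain z w where a: "a \<in> carrier M" and b: "b \<in> carrier M"
      and z: "z \<in> carrier M" "?F a = ?E a z" and w: "w \<in> carrier M" "?F b = ?E b w" by blast
    let ?n = "(\<ominus>\<^bsub>M\<^esub> b) [^]\<^bsub>M\<^esub> p"
    have nb: "\<ominus>\<^bsub>M\<^esub> b \<in> carrier M" using b by (rule M.a_inv_closed)
    have sub: "x - y = x \<ominus>\<^bsub>M\<^esub> y" if "y \<in> carrier M" for x y
      using that by (simp add: M.minus_eq M_uminus)
    obtain v where v: "v \<in> carrier M"
      "(a \<oplus>\<^bsub>M\<^esub> \<ominus>\<^bsub>M\<^esub> b) [^]\<^bsub>M\<^esub> p = a [^]\<^bsub>M\<^esub> p \<oplus>\<^bsub>M\<^esub> ?n \<oplus>\<^bsub>M\<^esub> ?P \<otimes>\<^bsub>M\<^esub> v"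
      using M.prime_pow_add[OF p M.oneideal a nb] by blast
    \<comment> \<open>Expanding the p-th power of b + (-b) = 0 relates (-b)^p to -(b^p) modulo
      \<open>p\<close>, without separating odd \<open>p\<close> from \<open>p = 2\<close>.\<close>
    obtain u where u: "u \<in> carrier M"
      "(b \<oplus>\<^bsub>M\<^esub> \<ominus>\<^bsub>M\<^esub> b) [^]\<^bsub>M\<^esub> p = b [^]\<^bsub>M\<^esub> p \<oplus>\<^bsub>M\<^esub> ?n \<oplus>\<^bsub>M\<^esub> ?P \<otimes>\<^bsub>M\<^esub> u"
      using M.prime_pow_add[OF p M.oneideal b nb] by blast
    have pow: "a [^]\<^bsub>M\<^esub> p \<in> carrier M" "b [^]\<^bsub>M\<^esub> p \<in> carrier M" "?n \<in> carrier M"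
      using a b nb by (simp_all only: M.nat_pow_closed)
    have Pu: "?P \<otimes>\<^bsub>M\<^esub> u \<in> carrier M" using P u(1) by (rule M.m_closed)
    have "b [^]\<^bsub>M\<^esub> p \<oplus>\<^bsub>M\<^esub> (?n \<oplus>\<^bsub>M\<^esub> ?P \<otimes>\<^bsub>M\<^esub> u) = \<zero>\<^bsub>M\<^esub>"
      using u(2) pow Pu by (simp only: M.r_neg[OF b] zero_pow M.a_assoc)
    then have bp: "b [^]\<^bsub>M\<^esub> p = \<ominus>\<^bsub>M\<^esub> (?n \<oplus>\<^bsub>M\<^esub> ?P \<otimes>\<^bsub>M\<^esub> u)"
      by (intro M.sum_zero_eq_neg pow M.add.m_closed Pu)
    have "?F (a - b) = ?E a z \<ominus>\<^bsub>M\<^esub> ?E b w"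
      unfolding M_map_simps z(2) w(2)
      by (intro sub M.add.m_closed M.m_closed pow P w(1))
    also have "\<dots> = (a [^]\<^bsub>M\<^esub> p \<oplus>\<^bsub>M\<^esub> ?n \<oplus>\<^bsub>M\<^esub> ?P \<otimes>\<^bsub>M\<^esub> v)
        \<oplus>\<^bsub>M\<^esub> ?P \<otimes>\<^bsub>M\<^esub> (u \<ominus>\<^bsub>M\<^esub> v \<oplus>\<^bsub>M\<^esub> z \<ominus>\<^bsub>M\<^esub> w)"
      unfolding bp by (rule M.frobenius_diff_aux[OF pow(1,3) P u(1) v(1) w(1) z(1)])
    also have "\<dots> = ?E (a - b) (u \<ominus>\<^bsub>M\<^esub> v \<oplus>\<^bsub>M\<^esub> z \<ominus>\<^bsub>M\<^esub> w)"
      unfolding sub[OF b] v(2)[symmetric] M.minus_eq ..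
    finally have "?F (a - b) = ?E (a - b) (u \<ominus>\<^bsub>M\<^esub> v \<oplus>\<^bsub>M\<^esub> z \<ominus>\<^bsub>M\<^esub> w)" .
    moreover have "u \<ominus>\<^bsub>M\<^esub> v \<oplus>\<^bsub>M\<^esub> z \<ominus>\<^bsub>M\<^esub> w \<in> carrier M"
      by (intro M.minus_closed M.add.m_closed u(1) v(1) w(1) z(1))
    moreover have "a - b \<in> carrier M"
      unfolding sub[OF b] by (intro M.minus_closed a b)
    ultimately show ?case by blast
  qed
  then show ?thesis ..
qed

text \<open>Perfectness enters twice: Frobenius of \<open>R\<close> is a ring homomorphism, so its
  induced map preserves the kernel of evaluation, and its inverse induces the inverse map with the
  same property.\<close>

lemma frobenius_lift_residue_monoid_algebra:
  fixes R :: "('a, 'b) ring_scheme"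
  assumes p: "Factorial_Ring.prime p" and R: "perfect_Fp_algebra p R"
  defines "f \<equiv> \<lambda>x. x [^]\<^bsub>R\<^esub> p"
  shows "frobenius_lift_residue (monoid_algebra R) (eval_kernel R) p
    (comm_monoid.M_map f) (comm_monoid.M_map (inv_into (carrier R) f)) R (eval_hom R)"
proof -
  have Fp: "Fp_algebra p R" and f_iso: "f \<in> ring_iso R R"
    using R by (auto simp: perfect_Fp_algebra_def f_def)
  then interpret R: cring R by (simp add: Fp_algebra_def)
  let ?M = "monoid_algebra R" and ?g = "inv_into (carrier R) f"
  interpret M: cring ?M by (rule R.cring_M)
  interpret \<pi>: ring_hom_cring ?M R "eval_hom R"
    using R.eval_hom_ring_hom by unfold_locales
  have g_iso: "?g \<in> ring_iso R R"
    by (rule ring_iso_set_sym[OF R.ring_axioms f_iso])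
  have f: "f \<in> ring_hom R R" and g: "?g \<in> ring_hom R R"
    using f_iso g_iso by (simp_all add: ring_iso_def)
  have bij: "bij_betw f (carrier R) (carrier R)" using f_iso by (simp add: ring_iso_def)
  have map_hom: "R.M_map h \<in> ring_hom ?M ?M" if "h \<in> ring_hom R R" for h
    using ring_hom_in_hom(1)[OF that] ring_hom_one[OF that] by (rule R.M_map_hom)
  have map_kernel: "R.M_map h ` eval_kernel R \<subseteq> eval_kernel R" if h: "h \<in> ring_hom R R" for h
  proof -
    interpret h: ring_hom_cring R R h using h by unfold_locales
    show ?thesis
    proof (rule image_subsetI)
      fix c assume "c \<in> eval_kernel R"
      then have c: "c \<in> carrier ?M" "eval_hom R c = \<zero>\<^bsub>R\<^esub>"
        unfolding eval_kernel_def a_kernel_def' by blast+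
      then have "eval_hom R (R.M_map h c) = \<zero>\<^bsub>R\<^esub>"
        using R.eval_hom_M_map[OF h c(1)] by (simp only: h.hom_zero)
      then show "R.M_map h c \<in> eval_kernel R"
        unfolding eval_kernel_def a_kernel_def' mem_Collect_eq
        using ring_hom_closed[OF map_hom[OF h] c(1)] by blast
    qed
  qed
  interpret I: ideal "eval_kernel R" ?M
    unfolding eval_kernel_def by (rule \<pi>.ring.kernel_is_ideal)
  have p_one: "[p] \<cdot>\<^bsub>?M\<^esub> \<one>\<^bsub>?M\<^esub> \<in> carrier ?M" by simp
  show ?thesis
  proof unfold_locales
    fix x assume x: "x \<in> carrier ?M" "([p] \<cdot>\<^bsub>?M\<^esub> \<one>\<^bsub>?M\<^esub>) \<otimes>\<^bsub>?M\<^esub> x = \<zero>\<^bsub>?M\<^esub>"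
    \<comment> \<open>Multiplication by \<open>p\<close> scales the integer coefficients, so there
      is no \<open>p\<close>-torsion.\<close>
    have "[p] \<cdot>\<^bsub>?M\<^esub> x = ([p] \<cdot>\<^bsub>?M\<^esub> \<one>\<^bsub>?M\<^esub>) \<otimes>\<^bsub>?M\<^esub> x"
      using M.add_pow_ldistr[OF M.one_closed x(1), of p] M.l_one[OF x(1)] by simp
    then have "frag_cmul (int p) x = 0" using x(2) by (simp add: R.M_add_pow)
    then show "x = \<zero>\<^bsub>?M\<^esub>" using prime_gt_0_nat[OF p] by simp
  next
    show "[p] \<cdot>\<^bsub>?M\<^esub> \<one>\<^bsub>?M\<^esub> \<in> eval_kernel R"
      using p_one \<pi>.hom_nat[of p] Fp_algebra_char[OF Fp]
      unfolding eval_kernel_def a_kernel_def' by (simp only: mem_Collect_eq simp_thms)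
  next
    fix x assume x: "x \<in> carrier ?M"
    show "R.M_map f (R.M_map ?g x) = x"
      using bij_betw_inv_into_right[OF bij] x by (rule R.M_map_inverse)
    show "R.M_map ?g (R.M_map f x) = x"
      using bij_betw_inv_into_left[OF bij] x by (rule R.M_map_inverse)
    show "\<exists>z\<in>carrier ?M. R.M_map f x = x [^]\<^bsub>?M\<^esub> p \<oplus>\<^bsub>?M\<^esub> ([p] \<cdot>\<^bsub>?M\<^esub> \<one>\<^bsub>?M\<^esub>) \<otimes>\<^bsub>?M\<^esub> z"
      unfolding f_def by (rule R.M_map_power_cong[OF p x])
  next
    show "eval_hom R ` carrier ?M = carrier R"
    proof (intro subset_antisym subsetI)
      fix r assume r: "r \<in> carrier R"
      show "r \<in> eval_hom R ` carrier ?M"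
        using R.eval_hom_frag_of[OF r, symmetric] R.frag_of_carrier[OF r] by (rule image_eqI)
    next
      fix r assume "r \<in> eval_hom R ` carrier ?M"
      then show "r \<in> carrier R" using R.eval_hom_closed by blast
    qed
  qed (rule p R map_hom[OF f] map_hom[OF g] map_kernel[OF f] map_kernel[OF g] eval_kernel_def)+
qed

theorem theorem1:
  fixes p :: nat and R :: "('a, 'b) ring_scheme"
  assumes "Factorial_Ring.prime p"
    and "perfect_Fp_algebra p R"
  shows "strict_p_ring p (C_ring R) (C_ideal R) \<and>
    (\<exists>\<phi> \<in> ring_iso (C_ring R Quot nat_ideal (C_ring R) p) R.
       \<forall>x \<in> carrier (C_ring R). \<phi> (nat_ideal (C_ring R) p +>\<^bsub>C_ring R\<^esub> x) = C_proj R x)"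
proof -
  interpret frobenius_lift_residue "monoid_algebra R" "eval_kernel R" p
    "comm_monoid.M_map (\<lambda>x. x [^]\<^bsub>R\<^esub> p)"
    "comm_monoid.M_map (inv_into (carrier R) (\<lambda>x. x [^]\<^bsub>R\<^esub> p))" R "eval_hom R"
    using assms by (rule frobenius_lift_residue_monoid_algebra)
  have eq: "C_ring R = C" "C_ideal R = completed_power (monoid_algebra R) (eval_kernel R)"
    "C_proj R = proj"
    by (simp_all add: fun_eq_iff C_ring_def C_ideal_def C_proj_def proj_def)
  \<comment> \<open>The first ideal of the filtration is pC, so the residue isomorphism is already
    the one modulo \<open>p\<close>.\<close>
  have ideal_p: "nat_ideal C p = completed_power (monoid_algebra R) (eval_kernel R) 1"
    using completed_power_eq_nat_ideal[of 1] by simp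
  show ?thesis
    unfolding eq ideal_p
    by (intro conjI bexI[OF _ residue_iso] ballI strict_p_ring_completion residue_iso_coset)
qed

end
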